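(* Let $L$ be a Moufang loop and $\mathcal N$ its associated $3$-net. Let $\Gamma_0$ be the group of collineations generated by the Bol reflections of $\mathcal N$, $\Gamma$ the direction preserving part of $\Gamma_0$, and $S\cong S_3$ the group generated by the Bol reflections whose axis contains the origin of $\mathcal N$. Then $\mathrm{Aut}(L)\cong C_{\mathrm{Aut}(\Gamma)}(S)$.
   Context: A loop is a set with a binary operation having a neutral element $1$ such that the equation $xy=z$ has a unique solution whenever two of the three elements $x,y,z$ are given. A Moufang loop is a loop satisfying $((xy)x)z=x(y(xz))$. $\mathrm{Aut}(L)$ is the group of bijections of $L$ preserving the multiplication. A $3$-net is an incidence structure $(\mathcal P,\mathcal L)$ of points and lines, where $\mathcal L$ is the disjoint union of three classes $\mathcal L_1,\mathcal L_2,\mathcal L_3$ such that two distinct lines of the same class have no common point, and any two lines of distinct classes meet in exactly one point. A line in $\mathcal L_i$ is called an $i$-line. The $3$-net associated with a loop $L$ has $\mathcal P=L\times L$, $\mathcal L_1=\{\{(c,y): y\in L\}: c\in L\}$, $\mathcal L_2=\{\{(x,c): x\in L\}: c\in L\}$, $\mathcal L_3=\{\{(x,y): x,y\in L,\ xy=c\}: c\in L\}$; its origin is the point $(1,1)$. A collineation is a permutation of $\mathcal P$ mapping lines to lines; it is direction preserving if each class $\mathcal L_i$ is invariant under the induced permutation of lines. The direction preserving part of a group of collineations is its subgroup of direction preserving elements. For a line $\ell\in\mathcal L_i$, with $\{i,j,k\}=\{1,2,3\}$, define a permutation $\sigma_\ell$ of $\mathcal P$ as follows: for $P\in\mathcal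 P$, let $a_j\in\mathcal L_j$ and $a_k\in\mathcal L_k$ be the lines through $P$, let $Q_j=a_j\cap\ell$ and $Q_k=a_k\cap \ell$, let $b_j$ be the $j$-line through $Q_k$ and $b_k$ the $k$-line through $Q_j$; then $\sigma_\ell(P)=b_j\cap b_k$. If $\sigma_\ell$ is a collineation, it is called the Bol reflection with axis $\ell$. For the $3$-net of a Moufang loop it is known that $\sigma_\ell$ is a collineation for every line $\ell$, so every $\sigma_\ell$ is a Bol reflection. It is known that $\Gamma$ is a normal subgroup of $\Gamma_0$ and $\Gamma_0=\Gamma S$. The group $S$ is regarded as acting on $\Gamma$ by identifying $s\in S$ with the automorphism $\tau\mapsto s\tau s^{-1}$ of $\Gamma$; $C_{\mathrm{Aut}(\Gamma)}(S)$ denotes the subgroup of those automorphisms of $\Gamma$ that commute with all of these automorphisms. *)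

theory Defs
  imports "HOL-Algebra.Algebra"
begin

section \<open>Moufang loops\<close>

text \<open>A loop is carried by the library's \<^typ>\<open>'a monoid\<close> record, which has no associativity built
  in.  In particular \<^const>\<open>AutoGroup\<close> is meaningful for it: its carrier consists of the
  (extensional) bijections of the carrier that preserve the multiplication.\<close>

locale loop =
  fixes L (structure)
  assumes mult_closed: "x \<in> carrier L \<Longrightarrow> y \<in> carrier L \<Longrightarrow> x \<otimes> y \<in> carrier L"
    and one_closed: "\<one> \<in> carrier L"
    and one_left: "x \<in> carrier L \<Longrightarrow> \<one> \<otimes> x = x"
    and one_right: "x \<in> carrier L \<Longrightarrow> x \<otimes> \<one> = x"
    and left_factor: "y \<in> carrier L \<Longrightarrow> z \<in> carrier L \<Longrightarrow> \<exists>!x. x \<in> carrier L \<and> x \<otimes> y = z"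
    and right_factor: "x \<in> carrier L \<Longrightarrow> z \<in> carrier L \<Longrightarrow> \<exists>!y. y \<in> carrier L \<and> x \<otimes> y = z"

locale moufang_loop = loop +
  assumes moufang: "x \<in> carrier L \<Longrightarrow> y \<in> carrier L \<Longrightarrow> z \<in> carrier L \<Longrightarrow>
    ((x \<otimes> y) \<otimes> x) \<otimes> z = x \<otimes> (y \<otimes> (x \<otimes> z))"


section \<open>3-nets\<close>

datatype direction = Dir1 | Dir2 | Dir3

text \<open>Lines are sets of points.  The disjoint union of the three line classes is rendered by
  indexing them with \<^typ>\<open>direction\<close>; the classes are not required to be disjoint as sets of
  point sets, so that the one-point net of the trivial loop is covered.\<close>

record 'p net =
  points :: "'p set"
  lines :: "direction \<Rightarrow> 'p set set"

definition three_net :: "'p net \<Rightarrow> bool" where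
  "three_net N \<longleftrightarrow>
     (\<forall>i. \<forall>l\<in>lines N i. l \<subseteq> points N) \<and>
     (\<forall>i. \<forall>l\<in>lines N i. \<forall>m\<in>lines N i. l \<noteq> m \<longrightarrow> l \<inter> m = {}) \<and>
     (\<forall>i j. i \<noteq> j \<longrightarrow> (\<forall>l\<in>lines N i. \<forall>m\<in>lines N j. \<exists>!P. P \<in> l \<inter> m))"

definition loop_net :: "('a, 'b) monoid_scheme \<Rightarrow> ('a \<times> 'a) net" where
  "loop_net L =
     \<lparr>points = carrier L \<times> carrier L,
      lines = (\<lambda>i. case i of
         Dir1 \<Rightarrow> {{(c, y) | y. y \<in> carrier L} | c. c \<in> carrier L}
       | Dir2 \<Rightarrow> {{(x, c) | x. x \<in> carrier L} | c. c \<in> carrier L}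
       | Dir3 \<Rightarrow> {{(x, y) | x y. x \<in> carrier L \<and> y \<in> carrier L \<and> x \<otimes>\<^bsub>L\<^esub> y = c} | c. c \<in> carrier L})\<rparr>"

definition net_origin :: "('a, 'b) monoid_scheme \<Rightarrow> 'a \<times> 'a" where
  "net_origin L = (\<one>\<^bsub>L\<^esub>, \<one>\<^bsub>L\<^esub>)"


section \<open>Collineations and Bol reflections\<close>

definition collineations :: "'p net \<Rightarrow> ('p \<Rightarrow> 'p) set" where
  "collineations N =
     {f \<in> Bij (points N). \<forall>l\<in>(\<Union>i. lines N i). f ` l \<in> (\<Union>i. lines N i)}"

definition direction_preserving :: "'p net \<Rightarrow> ('p \<Rightarrow> 'p) \<Rightarrow> bool" where
  "direction_preserving N f \<longleftrightarrow> (\<forall>i. (\<lambda>l. f ` l) ` lines N i = lines N i)"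

definition line_through :: "'p net \<Rightarrow> direction \<Rightarrow> 'p \<Rightarrow> 'p set" where
  "line_through N i P = (THE l. l \<in> lines N i \<and> P \<in> l)"

definition meet_point :: "'p set \<Rightarrow> 'p set \<Rightarrow> 'p" where
  "meet_point l m = (THE P. P \<in> l \<inter> m)"

text \<open>The permutation attached to a line \<open>l\<close> whose direction is the one different from
  \<open>j\<close> and \<open>k\<close>.\<close>

definition bol_map :: "'p net \<Rightarrow> direction \<Rightarrow> direction \<Rightarrow> 'p set \<Rightarrow> 'p \<Rightarrow> 'p" where
  "bol_map N j k l = (\<lambda>P\<in>points N.
     let Q\<^sub>j = meet_point (line_through N j P) l;
         Q\<^sub>k = meet_point (line_through N k P) l
     in meet_point (line_through N j Q\<^sub>k) (line_through N k Q\<^sub>j))"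

definition bol_reflection :: "'p net \<Rightarrow> 'p set \<Rightarrow> ('p \<Rightarrow> 'p) \<Rightarrow> bool" where
  "bol_reflection N l s \<longleftrightarrow>
     s \<in> collineations N \<and>
     (\<exists>i j k. {i, j, k} = {Dir1, Dir2, Dir3} \<and> l \<in> lines N i \<and> s = bol_map N j k l)"


section \<open>The groups generated by Bol reflections\<close>

text \<open>All groups of collineations are taken inside the full permutation group
  \<^term>\<open>BijGroup (points N)\<close>.\<close>

definition Gamma0 :: "'p net \<Rightarrow> ('p \<Rightarrow> 'p) monoid" where
  "Gamma0 N = BijGroup (points N)
     \<lparr>carrier := generate (BijGroup (points N)) {s. \<exists>l. bol_reflection N l s}\<rparr>"

definition Gamma :: "'p net \<Rightarrow> ('p \<Rightarrow> 'p) monoid" where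
  "Gamma N = BijGroup (points N)
     \<lparr>carrier := {f \<in> carrier (Gamma0 N). direction_preserving N f}\<rparr>"

definition origin_group :: "'p net \<Rightarrow> 'p \<Rightarrow> ('p \<Rightarrow> 'p) monoid" where
  "origin_group N p = BijGroup (points N)
     \<lparr>carrier := generate (BijGroup (points N)) {s. \<exists>l. p \<in> l \<and> bol_reflection N l s}\<rparr>"

definition conjugation :: "'p net \<Rightarrow> ('p \<Rightarrow> 'p) \<Rightarrow> ('p \<Rightarrow> 'p) \<Rightarrow> ('p \<Rightarrow> 'p)" where
  "conjugation N s =
     (\<lambda>t\<in>carrier (Gamma N). s \<otimes>\<^bsub>BijGroup (points N)\<^esub> t \<otimes>\<^bsub>BijGroup (points N)\<^esub> inv\<^bsub>BijGroup (points N)\<^esub> s)"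

definition centralizer :: "('a, 'b) monoid_scheme \<Rightarrow> 'a set \<Rightarrow> 'a set" where
  "centralizer G A = {x \<in> carrier G. \<forall>a\<in>A. x \<otimes>\<^bsub>G\<^esub> a = a \<otimes>\<^bsub>G\<^esub> x}"

definition aut_centralizer :: "'p net \<Rightarrow> 'p \<Rightarrow> (('p \<Rightarrow> 'p) \<Rightarrow> ('p \<Rightarrow> 'p)) monoid" where
  "aut_centralizer N p = AutoGroup (Gamma N)
     \<lparr>carrier := centralizer (AutoGroup (Gamma N))
        (conjugation N ` carrier (origin_group N p))\<rparr>"


section \<open>Well-definedness for the net of a loop\<close>

context loop
begin

lemma loop_net_line_through_unique:
  assumes "P \<in> points (loop_net L)"
  shows "\<exists>!l. l \<in> lines (loop_net L) i \<and> P \<in> l"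
  using assms mult_closed by (cases i) (auto simp: loop_net_def)

lemma loop_net_three_net: "three_net (loop_net L)"
proof -
  have sub: "l \<subseteq> points (loop_net L)" if "l \<in> lines (loop_net L) i" for i l
    using that by (cases i) (auto simp: loop_net_def)
  have disj: "l \<inter> m = {}" if "l \<in> lines (loop_net L) i" "m \<in> lines (loop_net L) i" "l \<noteq> m" for i l m
    using that by (cases i) (auto simp: loop_net_def)
  have m12: "\<exists>!P. P \<in> l \<inter> m" if "l \<in> lines (loop_net L) Dir1" "m \<in> lines (loop_net L) Dir2" for l m
    using that by (auto simp: loop_net_def)
  have m13: "\<exists>!P. P \<in> l \<inter> m"
    if l: "l \<in> lines (loop_net L) Dir1" and m: "m \<in> lines (loop_net L) Dir3" for l m
  proof -
    obtain c where c: "c \<in> carrier L" "l = {(c, y) | y. y \<in> carrier L}"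
      using l by (auto simp: loop_net_def)
    obtain d where d: "d \<in> carrier L"
      "m = {(x, y) | x y. x \<in> carrier L \<and> y \<in> carrier L \<and> x \<otimes> y = d}"
      using m by (auto simp: loop_net_def)
    have "\<exists>!y. y \<in> carrier L \<and> c \<otimes> y = d"
      using c(1) d(1) by (rule right_factor)
    then obtain y where y: "y \<in> carrier L \<and> c \<otimes> y = d"
      and uniq: "\<forall>y'. y' \<in> carrier L \<and> c \<otimes> y' = d \<longrightarrow> y' = y"
      by (rule ex1E)
    show ?thesis
    proof (rule ex1I)
      show "(c, y) \<in> l \<inter> m" using y c d by simp
      show "P = (c, y)" if "P \<in> l \<inter> m" for P
        using that uniq unfolding c(2) d(2) by auto
    qed
  qed
  have m23: "\<exists>!P. P \<in> l \<inter> m"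
    if l: "l \<in> lines (loop_net L) Dir2" and m: "m \<in> lines (loop_net L) Dir3" for l m
  proof -
    obtain c where c: "c \<in> carrier L" "l = {(x, c) | x. x \<in> carrier L}"
      using l by (auto simp: loop_net_def)
    obtain d where d: "d \<in> carrier L"
      "m = {(x, y) | x y. x \<in> carrier L \<and> y \<in> carrier L \<and> x \<otimes> y = d}"
      using m by (auto simp: loop_net_def)
    have "\<exists>!x. x \<in> carrier L \<and> x \<otimes> c = d"
      using c(1) d(1) by (rule left_factor)
    then obtain x where x: "x \<in> carrier L \<and> x \<otimes> c = d"
      and uniq: "\<forall>x'. x' \<in> carrier L \<and> x' \<otimes> c = d \<longrightarrow> x' = x"
      by (rule ex1E)
    show ?thesis
    proof (rule ex1I)
      show "(x, c) \<in> l \<inter> m" using x c d by simp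
      show "P = (x, c)" if "P \<in> l \<inter> m" for P
        using that uniq unfolding c(2) d(2) by auto
    qed
  qed
  have meet: "\<exists>!P. P \<in> l \<inter> m"
    if "i \<noteq> j" "l \<in> lines (loop_net L) i" "m \<in> lines (loop_net L) j" for i j l m
    using that m12[of l m] m13[of l m] m23[of l m] m12[of m l] m13[of m l] m23[of m l]
    by (cases i; cases j) (simp_all add: conj_commute)
  show ?thesis
    unfolding three_net_def using sub disj meet by simp
qed

end

end

theory Submission
  imports Defs
begin

text \<open>An automorphism \<open>u\<close> of \<open>L\<close> acts on the net by \<open>(x, y) \<mapsto> (u x, u y)\<close>.  This collineation fixes
  the origin, hence commutes with \<open>S\<close>, and conjugation by it is the automorphism of \<open>\<Gamma>\<close> attached to
  \<open>u\<close>.  To invert this construction, let \<open>\<sigma>\<close> be the reflection in the \<open>i\<close>-line with coordinate \<open>m\<close> and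
  \<open>s\<close> the one in the \<open>i\<close>-line through the origin.  The products \<open>\<sigma> s\<close> (called \<open>shift i m\<close>) generate
  \<open>\<Gamma>\<close>, because \<open>\<Gamma>\<^sub>0\<close> is their span times \<open>S\<close> and only the identity of \<open>S\<close> preserves directions.
  Since \<open>\<sigma> = g s g\<^sup>-\<^sup>1\<close> for some \<open>g\<close> in \<open>\<Gamma>\<close>, an automorphism \<open>\<alpha>\<close> of \<open>\<Gamma>\<close> commuting with \<open>S\<close> permutes the
  shifts of each direction.  Conjugation by \<open>S\<close> interchanges the directions, so \<open>\<alpha>\<close> acts on all three
  kinds of shifts by one and the same permutation \<open>u\<close> of \<open>L\<close>, and the identity
  \<open>shift\<^sub>3 (xy) = shift\<^sub>1 x \<cdot> shift\<^sub>3 y \<cdot> shift\<^sub>2 x\<close> makes \<open>u\<close> multiplicative.\<close>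

section \<open>Identities in Moufang loops\<close>

context moufang_loop
begin

lemma left_cancel:
  assumes "x \<in> carrier L" "y \<in> carrier L" "z \<in> carrier L" "x \<otimes> y = x \<otimes> z"
  shows "y = z"
  using assms right_factor[of x "x \<otimes> z"] mult_closed by metis

lemma right_cancel:
  assumes "x \<in> carrier L" "y \<in> carrier L" "z \<in> carrier L" "y \<otimes> x = z \<otimes> x"
  shows "y = z"
  using assms left_factor[of x "z \<otimes> x"] mult_closed by metis

lemma flexible:
  assumes "x \<in> carrier L" "y \<in> carrier L"
  shows "x \<otimes> (y \<otimes> x) = (x \<otimes> y) \<otimes> x"
  using moufang[of x y \<one>] assms one_closed mult_closed one_right by simp

text \<open>The solution \<open>y\<close> of xy = 1 works: the Moufang identity turns x(y(xz)) into
  ((xy)x)z = xz, and \<open>x\<close> cancels on the left.\<close>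

lemma ex_left_inverse:
  assumes "x \<in> carrier L"
  shows "\<exists>y\<in>carrier L. \<forall>z\<in>carrier L. y \<otimes> (x \<otimes> z) = z"
proof -
  obtain y where y: "y \<in> carrier L" "x \<otimes> y = \<one>"
    using right_factor[OF assms one_closed] by blast
  have "y \<otimes> (x \<otimes> z) = z" if "z \<in> carrier L" for z
  proof -
    have "x \<otimes> (y \<otimes> (x \<otimes> z)) = x \<otimes> z"
      using moufang[of x y z] assms y that one_left by simp
    then show ?thesis using left_cancel[of x] assms y that mult_closed by simp
  qed
  then show ?thesis using y by blast
qed

text \<open>\<open>m_inv\<close> is a definite description of a two-sided inverse, so using it
  requires existence and uniqueness; both come from cancellation here, without
  associativity.\<close>

lemma inverse_properties:
  assumes "x \<in> carrier L"
  shows "inv x \<in> carrier L \<and> x \<otimes> inv x = \<one> \<and> inv x \<otimes> x = \<one>"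
proof -
  obtain y where y: "y \<in> carrier L" "\<And>z. z \<in> carrier L \<Longrightarrow> y \<otimes> (x \<otimes> z) = z"
    using ex_left_inverse[OF assms] by blast
  have yx: "y \<otimes> x = \<one>" using y(2)[OF one_closed] assms one_right by simp
  have "y \<otimes> (x \<otimes> y) = y \<otimes> \<one>" using y one_right by simp
  then have xy: "x \<otimes> y = \<one>" using left_cancel y(1) assms mult_closed one_closed by blast
  have "\<exists>!y. y \<in> carrier L \<and> x \<otimes> y = \<one> \<and> y \<otimes> x = \<one>"
    using y(1) xy yx left_cancel[OF assms] by auto
  from theI'[OF this] show ?thesis unfolding m_inv_def by simp
qed

lemma inv_closed: "x \<in> carrier L \<Longrightarrow> inv x \<in> carrier L"
  and right_inv: "x \<in> carrier L \<Longrightarrow> x \<otimes> inv x = \<one>"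
  and left_inv: "x \<in> carrier L \<Longrightarrow> inv x \<otimes> x = \<one>"
  using inverse_properties by blast+

lemma inv_eqI:
  assumes "x \<in> carrier L" "y \<in> carrier L" "x \<otimes> y = \<one>"
  shows "inv x = y"
  using assms left_cancel[of x] right_inv inv_closed by metis

lemma inv_inv: "x \<in> carrier L \<Longrightarrow> inv (inv x) = x"
  using inv_eqI left_inv inv_closed by blast

lemma inv_one: "inv \<one> = \<one>"
  using inv_eqI one_closed one_left by blast

lemma inv_mult_cancel:
  assumes "x \<in> carrier L" "z \<in> carrier L"
  shows "inv x \<otimes> (x \<otimes> z) = z"
proof -
  obtain y where y: "y \<in> carrier L" "\<And>z. z \<in> carrier L \<Longrightarrow> y \<otimes> (x \<otimes> z) = z"
    using ex_left_inverse[OF assms(1)] by blast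
  have "y \<otimes> x = \<one>" using y(2)[OF one_closed] assms one_right by simp
  then have "inv x = y"
    using right_cancel[of x] left_inv assms y(1) inv_closed by metis
  then show ?thesis using y assms by simp
qed

lemma mult_inv_cancel: "x \<in> carrier L \<Longrightarrow> z \<in> carrier L \<Longrightarrow> x \<otimes> (inv x \<otimes> z) = z"
  using inv_mult_cancel[of "inv x"] inv_inv inv_closed by simp

lemma mult_inv_cancel_right:
  assumes "x \<in> carrier L" "z \<in> carrier L"
  shows "(z \<otimes> x) \<otimes> inv x = z"
proof -
  \<comment> \<open>Writing z as xy gives (zx)x^{-1} the shape ((xy)x)x^{-1}, to which the Moufang
    identity applies.\<close>
  obtain y where y: "y \<in> carrier L" "x \<otimes> y = z" using right_factor assms by blast
  have "((x \<otimes> y) \<otimes> x) \<otimes> inv x = x \<otimes> y"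
    using moufang[of x y "inv x"] assms y right_inv one_right inv_closed by simp
  then show ?thesis using y by simp
qed

lemma inv_mult_cancel_right: "x \<in> carrier L \<Longrightarrow> z \<in> carrier L \<Longrightarrow> (z \<otimes> inv x) \<otimes> x = z"
  using mult_inv_cancel_right[of "inv x"] inv_inv inv_closed by simp

lemma inv_mult:
  assumes "x \<in> carrier L" "y \<in> carrier L"
  shows "inv (x \<otimes> y) = inv y \<otimes> inv x"
proof -
  have "inv x = (inv x \<otimes> (x \<otimes> y)) \<otimes> inv (x \<otimes> y)"
    using assms mult_inv_cancel_right inv_closed mult_closed by simp
  also have "\<dots> = y \<otimes> inv (x \<otimes> y)" using assms inv_mult_cancel by simp
  finally show ?thesis using assms inv_mult_cancel inv_closed mult_closed by simp
qed

text \<open>Inversion is an anti-automorphism, so this is the mirror image of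
  \<open>moufang\<close>: apply that identity to the inverses and invert both sides.\<close>

lemma right_moufang:
  assumes "x \<in> carrier L" "y \<in> carrier L" "z \<in> carrier L"
  shows "((z \<otimes> x) \<otimes> y) \<otimes> x = z \<otimes> ((x \<otimes> y) \<otimes> x)"
proof -
  have "inv (((inv x \<otimes> inv y) \<otimes> inv x) \<otimes> inv z) = inv (inv x \<otimes> (inv y \<otimes> (inv x \<otimes> inv z)))"
    using moufang[of "inv x" "inv y" "inv z"] assms inv_closed by simp
  then show ?thesis
    using assms by (simp add: inv_mult inv_inv inv_closed mult_closed flexible)
qed

text \<open>Substitute z = xw: \<open>moufang\<close> collects x(y(xw)) into ((xy)x)w, and
  \<open>right_moufang\<close> regroups the product of this with a further x on the right.\<close>

lemma middle_moufang:
  assumes "x \<in> carrier L" "y \<in> carrier L" "z \<in> carrier L"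
  shows "(x \<otimes> y) \<otimes> (z \<otimes> x) = (x \<otimes> (y \<otimes> z)) \<otimes> x"
proof -
  let ?w = "inv x \<otimes> z"
  have w: "?w \<in> carrier L" using assms inv_closed mult_closed by simp
  have "x \<otimes> (y \<otimes> z) = ((x \<otimes> y) \<otimes> x) \<otimes> ?w"
    using moufang[of x y ?w] assms w mult_inv_cancel by simp
  then have "(x \<otimes> (y \<otimes> z)) \<otimes> x = (x \<otimes> y) \<otimes> ((x \<otimes> ?w) \<otimes> x)"
    using right_moufang[of x ?w "x \<otimes> y"] assms w mult_closed by simp
  then show ?thesis using assms mult_inv_cancel by simp
qed

lemmas loop_closed = mult_closed one_closed inv_closed
lemmas loop_simps = loop_closed one_left one_right inv_inv inv_one left_inv right_inv inv_mult_cancel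
  mult_inv_cancel mult_inv_cancel_right inv_mult_cancel_right inv_mult

end


section \<open>Conjugation and generation in groups\<close>

context group
begin

lemma inv_cancel_left: "x \<in> carrier G \<Longrightarrow> y \<in> carrier G \<Longrightarrow> inv x \<otimes> (x \<otimes> y) = y"
  by (simp flip: m_assoc)

lemma cancel_inv_left: "x \<in> carrier G \<Longrightarrow> y \<in> carrier G \<Longrightarrow> x \<otimes> (inv x \<otimes> y) = y"
  by (simp flip: m_assoc)

lemma conj_mult:
  assumes "x \<in> carrier G" "t \<in> carrier G" "u \<in> carrier G"
  shows "x \<otimes> (t \<otimes> u) \<otimes> inv x = (x \<otimes> t \<otimes> inv x) \<otimes> (x \<otimes> u \<otimes> inv x)"
  using assms by (simp add: m_assoc inv_cancel_left)

lemma generate_conj_closed: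
  assumes H: "H \<subseteq> carrier G" and x: "x \<in> carrier G"
    and conj: "\<And>h. h \<in> H \<Longrightarrow> x \<otimes> h \<otimes> inv x \<in> generate G H"
    and t: "t \<in> generate G H"
  shows "x \<otimes> t \<otimes> inv x \<in> generate G H"
  using t
proof (induction t rule: generate.induct)
  case one
  show ?case using x by (simp add: generate.one)
next
  case (incl h)
  then show ?case by (rule conj)
next
  case (inv h)
  then have "x \<otimes> inv h \<otimes> inv x = inv (x \<otimes> h \<otimes> inv x)"
    using H x by (auto simp: inv_mult_group m_assoc)
  then show ?case using generate_m_inv_closed[OF H conj[OF inv]] by simp
next
  case (eng h k)
  have hk: "h \<in> carrier G" "k \<in> carrier G"
    using generate_in_carrier[OF H] eng.hyps by auto
  then show ?case using generate.eng[OF eng.IH] conj_mult[OF x] by simp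
qed

text \<open>Peels generators off a word one at a time from the left, where
  \<open>generate.induct\<close> splits it into two arbitrary factors. The inner induction shows
  that left multiplication by \<open>h\<close> preserves \<open>P\<close>; this is then applied to
  the identity.\<close>

lemma generate_left_induct [consumes 1, case_names closed inv one mult]:
  assumes "h \<in> generate G H"
    and H: "H \<subseteq> carrier G" and inv: "\<And>h. h \<in> H \<Longrightarrow> inv h \<in> H"
    and one: "P \<one>" and mult: "\<And>h k. h \<in> H \<Longrightarrow> k \<in> carrier G \<Longrightarrow> P k \<Longrightarrow> P (h \<otimes> k)"
  shows "P h"
proof -
  have "\<forall>k\<in>carrier G. P k \<longrightarrow> P (h \<otimes> k)"
    using assms(1)
  proof (induction h rule: generate.induct)
    case (eng h1 h2)
    then show ?case using generate_in_carrier[OF H] by (simp add: m_assoc)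
  qed (use inv mult in auto)
  then have "P (h \<otimes> \<one>)" using one by simp
  then show ?thesis using generate_in_carrier[OF H assms(1)] by simp
qed

text \<open>Both inclusions are required because a conjugate of an infinite \<open>T\<close> may lie
  properly inside \<open>T\<close>; the second one provides the inverse of
  \<open>conj_on T x\<close>.\<close>

definition normalizes :: "'a set \<Rightarrow> 'a \<Rightarrow> bool" where
  "normalizes T x \<longleftrightarrow> x \<in> carrier G \<and>
     (\<forall>t\<in>T. x \<otimes> t \<otimes> inv x \<in> T) \<and> (\<forall>t\<in>T. inv x \<otimes> t \<otimes> x \<in> T)"

text \<open>Restricted to \<open>T\<close> so as to be extensional, like the elements of
  \<open>AutoGroup\<close>.\<close>

definition conj_on :: "'a set \<Rightarrow> 'a \<Rightarrow> 'a \<Rightarrow> 'a" where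
  "conj_on T x = (\<lambda>t\<in>T. x \<otimes> t \<otimes> inv x)"

lemma normalizes_generateI:
  assumes "H \<subseteq> carrier G" "x \<in> carrier G"
    and "\<And>h. h \<in> H \<Longrightarrow> x \<otimes> h \<otimes> inv x \<in> H" "\<And>h. h \<in> H \<Longrightarrow> inv x \<otimes> h \<otimes> x \<in> H"
  shows "normalizes (generate G H) x"
proof -
  have "x \<otimes> t \<otimes> inv x \<in> generate G H" "inv x \<otimes> t \<otimes> x \<in> generate G H"
    if "t \<in> generate G H" for t
    using generate_conj_closed[of H x t] generate_conj_closed[of H "inv x" t] that assms
    by (auto intro: generate.incl)
  then show ?thesis using assms by (simp add: normalizes_def)
qed

lemma normalizes_mult:
  assumes T: "T \<subseteq> carrier G" and "normalizes T x" "normalizes T y"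
  shows "normalizes T (x \<otimes> y)"
proof -
  have xy: "x \<in> carrier G" "y \<in> carrier G" using assms by (auto simp: normalizes_def)
  have "(x \<otimes> y) \<otimes> t \<otimes> inv (x \<otimes> y) = x \<otimes> (y \<otimes> t \<otimes> inv y) \<otimes> inv x"
    "inv (x \<otimes> y) \<otimes> t \<otimes> (x \<otimes> y) = inv y \<otimes> (inv x \<otimes> t \<otimes> x) \<otimes> y" if "t \<in> T" for t
    using that T xy by (auto simp: m_assoc inv_mult_group)
  then show ?thesis using assms xy by (simp add: normalizes_def)
qed

lemma conj_on_auto:
  assumes T: "subgroup T G" and x: "normalizes T x"
  shows "conj_on T x \<in> auto (G\<lparr>carrier := T\<rparr>)"
proof -
  have xG: "x \<in> carrier G" using x by (simp add: normalizes_def)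
  have TG: "t \<in> carrier G" if "t \<in> T" for t using subgroup.mem_carrier[OF T that] .
  have "bij_betw (conj_on T x) T T"
  proof (rule bij_betw_byWitness[where f' = "conj_on T (inv x)"])
    show "\<forall>t\<in>T. conj_on T (inv x) (conj_on T x t) = t" "\<forall>t\<in>T. conj_on T x (conj_on T (inv x) t) = t"
      using x xG TG by (auto simp: conj_on_def normalizes_def m_assoc inv_cancel_left cancel_inv_left)
    show "conj_on T x ` T \<subseteq> T" "conj_on T (inv x) ` T \<subseteq> T"
      using x xG by (auto simp: conj_on_def normalizes_def)
  qed
  then show ?thesis
    using x TG by (auto simp: auto_def hom_def Bij_def conj_on_def normalizes_def conj_mult
        subgroup.m_closed[OF T])
qed

lemma compose_conj_on:
  assumes T: "subgroup T G" and x: "normalizes T x" and y: "normalizes T y"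
  shows "compose T (conj_on T x) (conj_on T y) = conj_on T (x \<otimes> y)"
proof (rule ext)
  fix t
  have "x \<otimes> (y \<otimes> t \<otimes> inv y) \<otimes> inv x = (x \<otimes> y) \<otimes> t \<otimes> inv (x \<otimes> y)" if "t \<in> T"
    using x y subgroup.mem_carrier[OF T that] by (simp add: normalizes_def m_assoc inv_mult_group)
  then show "compose T (conj_on T x) (conj_on T y) t = conj_on T (x \<otimes> y) t"
    using y by (simp add: compose_def conj_on_def normalizes_def)
qed

lemma hom_eq_on_generate:
  assumes H: "H \<subseteq> carrier G" and inv: "\<And>h. h \<in> H \<Longrightarrow> inv h \<in> H"
    and f: "f \<in> hom (G\<lparr>carrier := generate G H\<rparr>) K" and g: "g \<in> hom (G\<lparr>carrier := generate G H\<rparr>) K"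
    and K: "group K" and eq: "\<And>h. h \<in> H \<Longrightarrow> f h = g h" and t: "t \<in> generate G H"
  shows "f t = g t"
  using t
proof (induction t rule: generate.induct)
  case one
  have "group (G\<lparr>carrier := generate G H\<rparr>)"
    using subgroup.subgroup_is_group[OF generate_is_subgroup[OF H] group_axioms] .
  then show ?case using hom_one[OF f _ K] hom_one[OF g _ K] by simp
next
  case (eng h k)
  then show ?case using hom_mult[OF f] hom_mult[OF g] by simp
qed (use inv eq in auto)

end

lemma AutoGroup_mult:
  "f \<in> Bij (carrier G) \<Longrightarrow> g \<in> Bij (carrier G) \<Longrightarrow>
    f \<otimes>\<^bsub>AutoGroup G\<^esub> g = compose (carrier G) f g"
  by (simp add: AutoGroup_def BijGroup_def)

lemma BijGroup_mult:
  "f \<in> carrier (BijGroup A) \<Longrightarrow> g \<in> carrier (BijGroup A) \<Longrightarrow> f \<otimes>\<^bsub>BijGroup A\<^esub> g = compose A f g"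
  by (simp add: BijGroup_def)

lemma BijGroup_mult_apply:
  "f \<in> carrier (BijGroup A) \<Longrightarrow> g \<in> carrier (BijGroup A) \<Longrightarrow> x \<in> A \<Longrightarrow>
    (f \<otimes>\<^bsub>BijGroup A\<^esub> g) x = f (g x)"
  by (simp add: BijGroup_mult compose_eq)

lemma BijGroup_one_apply: "x \<in> A \<Longrightarrow> \<one>\<^bsub>BijGroup A\<^esub> x = x"
  by (simp add: BijGroup_def)

lemma BijGroup_apply_closed: "f \<in> carrier (BijGroup A) \<Longrightarrow> x \<in> A \<Longrightarrow> f x \<in> A"
  using Bij_imp_funcset[of f A] by (auto simp: BijGroup_def)

lemma BijGroup_eqI:
  assumes "f \<in> carrier (BijGroup A)" "g \<in> carrier (BijGroup A)" "\<And>x. x \<in> A \<Longrightarrow> f x = g x"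
  shows "f = g"
  using assms by (intro extensionalityI[of f A g]) (auto simp: BijGroup_def Bij_def)


section \<open>Bol reflections in coordinates\<close>

context moufang_loop
begin

abbreviation pts where "pts \<equiv> carrier L \<times> carrier L"

text \<open>The label of the i-line through a point. Lines become level sets of labels, and any two
  of the three labels determine the point.\<close>

fun coord :: "direction \<Rightarrow> 'a \<times> 'a \<Rightarrow> 'a" where
  "coord Dir1 p = fst p"
| "coord Dir2 p = snd p"
| "coord Dir3 p = fst p \<otimes> snd p"

definition net_line :: "direction \<Rightarrow> 'a \<Rightarrow> ('a \<times> 'a) set" where
  "net_line i c = {p \<in> pts. coord i p = c}"

lemma points_loop_net: "points (loop_net L) = pts"
  by (simp add: loop_net_def)

lemma coord_closed: "p \<in> pts \<Longrightarrow> coord i p \<in> carrier L"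
  by (cases i) (auto simp: mult_closed)

lemma coords_eqI:
  assumes "i \<noteq> j" "p \<in> pts" "q \<in> pts" "coord i p = coord i q" "coord j p = coord j q"
  shows "p = q"
  using assms by (cases i; cases j; cases p; cases q) (auto dest: left_cancel right_cancel)

lemma ex_coord: "c \<in> carrier L \<Longrightarrow> \<exists>p\<in>pts. coord i p = c"
  by (cases i) (auto simp: one_closed intro: bexI[OF _ one_closed] bexI[of _ c] one_right)

lemma lines_loop_net: "lines (loop_net L) i = net_line i ` carrier L"
  by (cases i) (auto simp: loop_net_def net_line_def image_iff)

lemma line_through_eq:
  assumes "p \<in> pts"
  shows "line_through (loop_net L) i p = net_line i (coord i p)"
  unfolding line_through_def lines_loop_net
  by (rule the_equality) (use assms coord_closed in \<open>auto simp: net_line_def\<close>)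

lemma meet_point_eq:
  assumes "i \<noteq> j" "q \<in> pts"
  shows "meet_point (net_line i (coord i q)) (net_line j (coord j q)) = q"
  unfolding meet_point_def
  by (rule the_equality) (use assms coords_eqI in \<open>auto simp: net_line_def\<close>)

text \<open>\<open>q\<^sub>j\<close> and \<open>q\<^sub>k\<close> are the points where the
  \<open>j\<close>-line and the \<open>k\<close>-line through \<open>p\<close> meet the axis. Naming
  all intersection points evaluates the definite descriptions in \<open>bol_map\<close>.\<close>

lemma bol_map_eq:
  assumes ijk: "{i, j, k} = {Dir1, Dir2, Dir3}"
    and pts: "p \<in> pts" "q\<^sub>j \<in> pts" "q\<^sub>k \<in> pts" "q \<in> pts"
    and q\<^sub>j: "coord j q\<^sub>j = coord j p" "coord i q\<^sub>j = c"
    and q\<^sub>k: "coord k q\<^sub>k = coord k p" "coord i q\<^sub>k = c"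
    and q: "coord j q = coord j q\<^sub>k" "coord k q = coord k q\<^sub>j"
  shows "bol_map (loop_net L) j k (net_line i c) p = q"
proof -
  have ne: "j \<noteq> i" "k \<noteq> i" "j \<noteq> k"
    using ijk by (cases i; cases j; cases k; auto)+
  have "meet_point (line_through (loop_net L) j p) (net_line i c) = q\<^sub>j"
    using meet_point_eq[OF ne(1) pts(2)] line_through_eq[OF pts(1)] q\<^sub>j by simp
  moreover have "meet_point (line_through (loop_net L) k p) (net_line i c) = q\<^sub>k"
    using meet_point_eq[OF ne(2) pts(3)] line_through_eq[OF pts(1)] q\<^sub>k by simp
  moreover have "meet_point (line_through (loop_net L) j q\<^sub>k) (line_through (loop_net L) k q\<^sub>j) = q"
    using meet_point_eq[OF ne(3) pts(4)] line_through_eq pts q by simp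
  ultimately show ?thesis
    using pts(1) by (simp add: bol_map_def points_loop_net)
qed

text \<open>Closed form of the reflection in the i-line labelled \<open>m\<close>. For direction 1
  the points on the axis are (m, y) and (m, m^{-1}(xy)); the image has second coordinate m^{-1}(xy)
  and product my, which leads to the first coordinate m x^{-1} m.\<close>

fun bol :: "direction \<Rightarrow> 'a \<Rightarrow> 'a \<times> 'a \<Rightarrow> 'a \<times> 'a" where
  "bol Dir1 m = (\<lambda>p\<in>pts. (m \<otimes> inv (fst p) \<otimes> m, inv m \<otimes> (fst p \<otimes> snd p)))"
| "bol Dir2 m = (\<lambda>p\<in>pts. ((fst p \<otimes> snd p) \<otimes> inv m, m \<otimes> inv (snd p) \<otimes> m))"
| "bol Dir3 m = (\<lambda>p\<in>pts. (m \<otimes> inv (snd p), inv (fst p) \<otimes> m))"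

text \<open>These are autotopisms of \<open>L\<close>: each label of the image depends only on the
  label of the same direction (\<open>coord_shift\<close>). They are products of two reflections
  with axes of one direction (\<open>shift_eq\<close>).\<close>

fun shift :: "direction \<Rightarrow> 'a \<Rightarrow> 'a \<times> 'a \<Rightarrow> 'a \<times> 'a" where
  "shift Dir1 m = (\<lambda>p\<in>pts. (m \<otimes> fst p \<otimes> m, inv m \<otimes> snd p))"
| "shift Dir2 m = (\<lambda>p\<in>pts. (fst p \<otimes> inv m, m \<otimes> snd p \<otimes> m))"
| "shift Dir3 m = (\<lambda>p\<in>pts. (m \<otimes> fst p, snd p \<otimes> m))"

text \<open>The direction to which a reflection with an i-axis sends direction d. The diagonal
  values say that the direction of the axis is kept.\<close>

fun third :: "direction \<Rightarrow> direction \<Rightarrow> direction" where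
  "third Dir1 Dir2 = Dir3" | "third Dir2 Dir1 = Dir3"
| "third Dir1 Dir3 = Dir2" | "third Dir3 Dir1 = Dir2"
| "third Dir2 Dir3 = Dir1" | "third Dir3 Dir2 = Dir1"
| "third Dir1 Dir1 = Dir1" | "third Dir2 Dir2 = Dir2" | "third Dir3 Dir3 = Dir3"

lemma bol_closed: "m \<in> carrier L \<Longrightarrow> p \<in> pts \<Longrightarrow> bol i m p \<in> pts"
  by (cases i) (auto simp: loop_closed)

lemma shift_closed: "m \<in> carrier L \<Longrightarrow> p \<in> pts \<Longrightarrow> shift i m p \<in> pts"
  by (cases i) (auto simp: loop_closed)

text \<open>In each of the three tables the label of direction \<open>d\<close> of the image depends
  only on the label of direction \<open>third i d\<close> of \<open>p\<close>; this makes
  reflections collineations. The formulas for the label of direction 3 use the left, right and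
  middle Moufang identity respectively.\<close>

lemma coord_bol_1:
  assumes "m \<in> carrier L" "p \<in> pts"
  shows "coord Dir1 (bol Dir1 m p) = m \<otimes> inv (coord Dir1 p) \<otimes> m"
    and "coord Dir2 (bol Dir1 m p) = inv m \<otimes> coord Dir3 p"
    and "coord Dir3 (bol Dir1 m p) = m \<otimes> coord Dir2 p"
  using assms by (auto simp: loop_simps moufang)

lemma coord_bol_2:
  assumes "m \<in> carrier L" "p \<in> pts"
  shows "coord Dir1 (bol Dir2 m p) = coord Dir3 p \<otimes> inv m"
    and "coord Dir2 (bol Dir2 m p) = m \<otimes> inv (coord Dir2 p) \<otimes> m"
    and "coord Dir3 (bol Dir2 m p) = coord Dir1 p \<otimes> m"
  using assms by (auto simp: loop_simps right_moufang[symmetric])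

lemma coord_bol_3:
  assumes "m \<in> carrier L" "p \<in> pts"
  shows "coord Dir1 (bol Dir3 m p) = m \<otimes> inv (coord Dir2 p)"
    and "coord Dir2 (bol Dir3 m p) = inv (coord Dir1 p) \<otimes> m"
    and "coord Dir3 (bol Dir3 m p) = m \<otimes> inv (coord Dir3 p) \<otimes> m"
  using assms by (auto simp: loop_simps middle_moufang)

lemmas coord_bol = coord_bol_1 coord_bol_2 coord_bol_3

lemma coord_relations:
  assumes "p \<in> pts"
  shows "coord Dir1 p \<otimes> coord Dir2 p = coord Dir3 p"
    and "inv (coord Dir1 p) \<otimes> coord Dir3 p = coord Dir2 p"
    and "coord Dir3 p \<otimes> inv (coord Dir2 p) = coord Dir1 p"
  using assms by (auto simp: loop_simps)

lemma ex_meet: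
  assumes "d \<noteq> i" "p \<in> pts" "m \<in> carrier L"
  shows "\<exists>q\<in>pts. coord d q = coord d p \<and> coord i q = m"
proof -
  have "net_line d (coord d p) \<in> lines (loop_net L) d" "net_line i m \<in> lines (loop_net L) i"
    using coord_closed assms by (simp_all add: lines_loop_net)
  then have "\<exists>!q. q \<in> net_line d (coord d p) \<inter> net_line i m"
    using loop_net_three_net assms unfolding three_net_def by simp
  then show ?thesis unfolding net_line_def by blast
qed

lemma bol_map_bol:
  assumes ijk: "{i, j, k} = {Dir1, Dir2, Dir3}" and m: "m \<in> carrier L"
  shows "bol_map (loop_net L) j k (net_line i m) = bol i m"
proof (rule extensionalityI[where A = pts])
  show "bol_map (loop_net L) j k (net_line i m) \<in> extensional pts"
    by (simp add: bol_map_def points_loop_net)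
  show "bol i m \<in> extensional pts" by (cases i) auto
next
  fix p assume p: "p \<in> pts"
  have ne: "j \<noteq> i" "k \<noteq> i" "j \<noteq> k"
    using ijk by (cases i; cases j; cases k; auto)+
  obtain a where a: "a \<in> pts" "coord j a = coord j p" "coord i a = m" using ex_meet[OF ne(1) p m] by blast
  obtain b where b: "b \<in> pts" "coord k b = coord k p" "coord i b = m" using ex_meet[OF ne(2) p m] by blast
  \<comment> \<open>By \<open>coord_bol\<close> these labels depend on \<open>p\<close> only through
    its \<open>k\<close>-label, shared with \<open>b\<close>, and its \<open>j\<close>-label, shared
    with \<open>a\<close>. Since \<open>a\<close> and \<open>b\<close> have \<open>i\<close>-label
    \<open>m\<close>, \<open>coord_relations\<close> computes their remaining labels.\<close>
  have "coord j (bol i m p) = coord j b" "coord k (bol i m p) = coord k a"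
    using ne a b coord_relations[OF a(1)] coord_relations[OF b(1)]
    by (cases i; cases j; cases k; simp add: coord_bol[OF m p] del: coord.simps bol.simps)+
  then show "bol_map (loop_net L) j k (net_line i m) p = bol i m p"
    using bol_map_eq[OF ijk p a(1) b(1) bol_closed[OF m p]] a b by blast
qed

text \<open>Only the two labels off the direction of the axis are compared; they are interchanged up
  to a translation, and an inversion for direction 3, which cancel on the second
  application.\<close>

lemma bol_bol:
  assumes "m \<in> carrier L" "p \<in> pts"
  shows "bol i m (bol i m p) = p"
proof (cases i)
  case Dir1
  have "coord d (bol Dir1 m (bol Dir1 m p)) = coord d p" if "d = Dir2 \<or> d = Dir3" for d
    using that assms by (auto simp: coord_bol bol_closed coord_closed loop_simps simp del: coord.simps bol.simps)
  then show ?thesis using Dir1 assms coords_eqI[of Dir2 Dir3] bol_closed by (metis direction.distinct)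
next
  case Dir2
  have "coord d (bol Dir2 m (bol Dir2 m p)) = coord d p" if "d = Dir1 \<or> d = Dir3" for d
    using that assms by (auto simp: coord_bol bol_closed coord_closed loop_simps simp del: coord.simps bol.simps)
  then show ?thesis using Dir2 assms coords_eqI[of Dir1 Dir3] bol_closed by (metis direction.distinct)
next
  case Dir3
  have "coord d (bol Dir3 m (bol Dir3 m p)) = coord d p" if "d = Dir1 \<or> d = Dir2" for d
    using that assms by (auto simp: coord_bol bol_closed coord_closed loop_simps simp del: coord.simps bol.simps)
  then show ?thesis using Dir3 assms coords_eqI[of Dir1 Dir2] bol_closed by (metis direction.distinct)
qed

lemma bol_Bij:
  assumes "m \<in> carrier L"
  shows "bol i m \<in> Bij pts"
proof -
  have "bij_betw (bol i m) pts pts"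
    by (rule bij_betw_byWitness[where f' = "bol i m"])
      (use bol_bol[OF assms] bol_closed[OF assms] in blast)+
  moreover have "bol i m \<in> extensional pts" by (cases i) auto
  ultimately show ?thesis by (simp add: Bij_def)
qed

text \<open>The forward half of the equivalence puts the image of the line inside a line; the
  backward half and surjectivity make it the whole line.\<close>

lemma Bij_image_net_line:
  assumes f: "f \<in> Bij pts" and p: "p \<in> pts"
    and ij: "\<And>q. q \<in> pts \<Longrightarrow> coord i p = coord i q \<longleftrightarrow> coord j (f p) = coord j (f q)"
  shows "f ` net_line i (coord i p) = net_line j (coord j (f p))"
proof -
  have im: "f ` pts = pts" using f by (simp add: Bij_def bij_betw_def)
  have "f ` net_line i (coord i p) = {f q | q. q \<in> pts \<and> coord j (f q) = coord j (f p)}"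
    using ij p unfolding net_line_def by force
  also have "\<dots> = {r \<in> f ` pts. coord j r = coord j (f p)}" by blast
  finally show ?thesis using im by (simp add: net_line_def)
qed

lemma coord_bol_cong:
  assumes "m \<in> carrier L" "p \<in> pts" "q \<in> pts" "coord d p = coord d q"
  shows "coord (third i d) (bol i m p) = coord (third i d) (bol i m q)"
  using assms by (cases i; cases d) (simp_all only: coord_bol third.simps)

lemma third_third: "third i (third i d) = d"
  by (cases i; cases d) simp_all

lemma bol_image_net_line:
  assumes m: "m \<in> carrier L" and p: "p \<in> pts"
  shows "bol i m ` net_line d (coord d p) = net_line (third i d) (coord (third i d) (bol i m p))"
proof (rule Bij_image_net_line[OF bol_Bij[OF m] p])
  fix q assume q: "q \<in> pts"
  show "coord d p = coord d q \<longleftrightarrow> coord (third i d) (bol i m p) = coord (third i d) (bol i m q)"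
  proof
    assume "coord (third i d) (bol i m p) = coord (third i d) (bol i m q)"
    \<comment> \<open>The same congruence applied to the images gives the converse, because the
      reflection and \<open>third i\<close> are involutions.\<close>
    note coord_bol_cong[OF m bol_closed[OF m p] bol_closed[OF m q] this, of i]
    then show "coord d p = coord d q" by (simp only: bol_bol[OF m p] bol_bol[OF m q] third_third)
  qed (rule coord_bol_cong[OF m p q])
qed

lemma bol_collineation:
  assumes m: "m \<in> carrier L"
  shows "bol i m \<in> collineations (loop_net L)"
proof -
  have "bol i m ` l \<in> (\<Union>j. lines (loop_net L) j)" if l: "l \<in> lines (loop_net L) d" for l d
  proof -
    obtain c where c: "c \<in> carrier L" "l = net_line d c" using l by (auto simp: lines_loop_net)
    obtain p where p: "p \<in> pts" "coord d p = c" using ex_coord[OF c(1)] by blast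
    have "bol i m ` l \<in> lines (loop_net L) (third i d)"
      using bol_image_net_line[OF m p(1), of i d] c(2) p(2)
        coord_closed[OF bol_closed[OF m p(1)], of "third i d"] unfolding lines_loop_net by blast
    then show ?thesis by blast
  qed
  then show ?thesis
    using bol_Bij[OF m] by (auto simp: collineations_def points_loop_net)
qed

lemma bol_reflection_iff:
  "bol_reflection (loop_net L) l s \<longleftrightarrow> (\<exists>i. \<exists>m\<in>carrier L. l = net_line i m \<and> s = bol i m)"
proof
  assume "bol_reflection (loop_net L) l s"
  then obtain i j k where ijk: "{i, j, k} = {Dir1, Dir2, Dir3}"
    and l: "l \<in> lines (loop_net L) i" and s: "s = bol_map (loop_net L) j k l"
    by (auto simp: bol_reflection_def)
  obtain m where "m \<in> carrier L" "l = net_line i m" using l by (auto simp: lines_loop_net)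
  then show "\<exists>i. \<exists>m\<in>carrier L. l = net_line i m \<and> s = bol i m"
    using s bol_map_bol[OF ijk] by blast
next
  assume "\<exists>i. \<exists>m\<in>carrier L. l = net_line i m \<and> s = bol i m"
  then obtain i m where m: "m \<in> carrier L" "l = net_line i m" "s = bol i m" by blast
  obtain j k where ijk: "{i, j, k} = {Dir1, Dir2, Dir3}" by (cases i) blast+
  have "s = bol_map (loop_net L) j k l" using bol_map_bol[OF ijk] m by simp
  moreover have "l \<in> lines (loop_net L) i" using m by (simp add: lines_loop_net)
  ultimately show "bol_reflection (loop_net L) l s"
    unfolding bol_reflection_def using ijk bol_collineation[OF m(1)] m(3) by metis
qed

lemma bol_reflections: "{s. \<exists>l. bol_reflection (loop_net L) l s} = {bol i m | i m. m \<in> carrier L}"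
  unfolding bol_reflection_iff by blast

lemma bol_reflections_origin:
  "{s. \<exists>l. net_origin L \<in> l \<and> bol_reflection (loop_net L) l s} = range (\<lambda>i. bol i \<one>)"
proof -
  have "net_origin L \<in> net_line i m \<longleftrightarrow> m = \<one>" for i m
    by (cases i) (auto simp: net_origin_def net_line_def one_closed one_left)
  then show ?thesis using one_closed by (auto simp: bol_reflection_iff)
qed


section \<open>Products of two reflections\<close>

declare coord.simps [simp del] bol.simps [simp del] shift.simps [simp del]

interpretation B: group "BijGroup pts"
  by (rule group_BijGroup)

abbreviation B where "B \<equiv> BijGroup pts"

abbreviation orig where "orig \<equiv> (\<one>, \<one>)"

lemma bol_in_B: "m \<in> carrier L \<Longrightarrow> bol i m \<in> carrier B"
  using bol_Bij by (simp add: BijGroup_def)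

lemma bol_mult_bol: "m \<in> carrier L \<Longrightarrow> bol i m \<otimes>\<^bsub>B\<^esub> bol i m = \<one>\<^bsub>B\<^esub>"
  by (rule BijGroup_eqI) (auto simp: bol_in_B BijGroup_mult_apply BijGroup_one_apply bol_bol)

lemma bol_mult_bol_assoc:
  "m \<in> carrier L \<Longrightarrow> f \<in> carrier B \<Longrightarrow> bol i m \<otimes>\<^bsub>B\<^esub> (bol i m \<otimes>\<^bsub>B\<^esub> f) = f"
  using bol_mult_bol[of m i] by (simp add: bol_in_B flip: B.m_assoc)

lemma inv_bol: "m \<in> carrier L \<Longrightarrow> inv\<^bsub>B\<^esub> (bol i m) = bol i m"
  by (rule B.inv_equality) (simp_all add: bol_in_B bol_mult_bol)

lemma coord_orig: "coord i orig = \<one>"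
  by (cases i) (simp_all add: coord.simps one_closed one_left)

lemma orig_pts: "orig \<in> pts"
  by (simp add: one_closed)

lemma coord_shift:
  assumes "m \<in> carrier L" "p \<in> pts"
  shows "coord Dir1 (shift Dir1 m p) = m \<otimes> coord Dir1 p \<otimes> m"
    and "coord Dir2 (shift Dir1 m p) = inv m \<otimes> coord Dir2 p"
    and "coord Dir3 (shift Dir1 m p) = m \<otimes> coord Dir3 p"
    and "coord Dir1 (shift Dir2 m p) = coord Dir1 p \<otimes> inv m"
    and "coord Dir2 (shift Dir2 m p) = m \<otimes> coord Dir2 p \<otimes> m"
    and "coord Dir3 (shift Dir2 m p) = coord Dir3 p \<otimes> m"
    and "coord Dir1 (shift Dir3 m p) = m \<otimes> coord Dir1 p"
    and "coord Dir2 (shift Dir3 m p) = coord Dir2 p \<otimes> m"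
    and "coord Dir3 (shift Dir3 m p) = m \<otimes> coord Dir3 p \<otimes> m"
  using assms
  by (auto simp: coord.simps shift.simps loop_simps moufang middle_moufang right_moufang[symmetric])

text \<open>Used with \<open>i\<close> the direction of an axis, the label that a reflection
  transforms in the most complicated way; the other two suffice.\<close>

lemma coords_off_eqI:
  assumes "p \<in> pts" "q \<in> pts" "\<And>d. d \<noteq> i \<Longrightarrow> coord d p = coord d q"
  shows "p = q"
proof -
  obtain j k where "j \<noteq> k" "j \<noteq> i" "k \<noteq> i"
    by (cases i) (use direction.distinct in metis)+
  then show ?thesis using coords_eqI assms by blast
qed

lemma shift_eq:
  assumes "m \<in> carrier L"
  shows "shift i m = bol i m \<otimes>\<^bsub>B\<^esub> bol i \<one>"
proof (rule extensionalityI[where A = pts])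
  show "shift i m \<in> extensional pts" by (cases i) (auto simp: shift.simps)
  have "bol i m \<otimes>\<^bsub>B\<^esub> bol i \<one> \<in> carrier B" using assms by (simp add: bol_in_B one_closed)
  then show "bol i m \<otimes>\<^bsub>B\<^esub> bol i \<one> \<in> extensional pts" by (simp add: BijGroup_def Bij_def)
next
  fix p assume p: "p \<in> pts"
  have "shift i m p = bol i m (bol i \<one> p)"
  proof (rule coords_off_eqI[where i = i])
    fix d assume "d \<noteq> i"
    then show "coord d (shift i m p) = coord d (bol i m (bol i \<one> p))"
      using assms p
      by (cases i; cases d)
        (simp_all add: coord_shift coord_bol bol_closed coord_closed loop_simps)
  qed (use assms p in \<open>auto simp: shift_closed bol_closed one_closed\<close>)
  then show "shift i m p = (bol i m \<otimes>\<^bsub>B\<^esub> bol i \<one>) p"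
    using assms p by (simp add: BijGroup_mult_apply bol_in_B one_closed)
qed

lemma shift_in_B: "m \<in> carrier L \<Longrightarrow> shift i m \<in> carrier B"
  by (simp add: shift_eq bol_in_B one_closed)

lemma bol_eq: "m \<in> carrier L \<Longrightarrow> bol i m = shift i m \<otimes>\<^bsub>B\<^esub> bol i \<one>"
  by (simp add: shift_eq bol_in_B one_closed B.m_assoc bol_mult_bol)

lemma inv_shift:
  assumes "m \<in> carrier L"
  shows "inv\<^bsub>B\<^esub> (shift i m) = shift i (inv m)"
proof (rule B.inv_equality)
  show "shift i (inv m) \<otimes>\<^bsub>B\<^esub> shift i m = \<one>\<^bsub>B\<^esub>"
  proof (rule BijGroup_eqI)
    fix p assume p: "p \<in> pts"
    have "shift i (inv m) (shift i m p) = p"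
    proof (rule coords_off_eqI[where i = i])
      fix d assume "d \<noteq> i"
      then show "coord d (shift i (inv m) (shift i m p)) = coord d p"
        using assms p
        by (cases i; cases d) (simp_all add: coord_shift shift_closed coord_closed loop_simps)
    qed (use assms p in \<open>auto simp: shift_closed inv_closed\<close>)
    then show "(shift i (inv m) \<otimes>\<^bsub>B\<^esub> shift i m) p = \<one>\<^bsub>B\<^esub> p"
      using assms p by (simp add: BijGroup_mult_apply BijGroup_one_apply shift_in_B inv_closed)
  qed (use assms in \<open>auto simp: shift_in_B inv_closed\<close>)
qed (use assms in \<open>auto simp: shift_in_B inv_closed\<close>)

text \<open>Conjugation by \<open>S\<close> permutes the three kinds of shifts. For
  \<open>centralizer_shift\<close> it matters that reflections 1 and 2 carry
  \<open>shift Dir3 m\<close> to \<open>shift Dir2 m\<close> and \<open>shift Dir1 m\<close> with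
  \<open>m\<close> itself, not its inverse.\<close>

lemma bol_conj_shift:
  assumes "m \<in> carrier L"
  shows "bol i \<one> \<otimes>\<^bsub>B\<^esub> shift j m \<otimes>\<^bsub>B\<^esub> bol i \<one> =
    shift (third i j) (if i = j \<or> i = Dir3 then inv m else m)" (is "_ = shift _ ?m")
proof (rule BijGroup_eqI)
  have m: "?m \<in> carrier L" using assms inv_closed by simp
  fix p assume p: "p \<in> pts"
  have "bol i \<one> (shift j m (bol i \<one> p)) = shift (third i j) ?m p"
  proof (rule coords_off_eqI[where i = i])
    fix d assume "d \<noteq> i"
    then show "coord d (bol i \<one> (shift j m (bol i \<one> p))) = coord d (shift (third i j) ?m p)"
      using assms p
      by (cases i; cases j; cases d)
        (simp_all add: coord_shift coord_bol bol_closed shift_closed coord_closed loop_simps flexible)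
  qed (use assms m p in \<open>auto simp: shift_closed bol_closed one_closed\<close>)
  then show "(bol i \<one> \<otimes>\<^bsub>B\<^esub> shift j m \<otimes>\<^bsub>B\<^esub> bol i \<one>) p = shift (third i j) ?m p"
    using assms p by (simp add: BijGroup_mult_apply bol_in_B shift_in_B one_closed bol_closed)
qed (use assms in \<open>auto simp: bol_in_B shift_in_B loop_closed\<close>)

text \<open>This relation stores the loop multiplication in the group. At the point (a, b) it says
  (x(y(ax^{-1})))x = (xy)a, by \<open>middle_moufang\<close>, and x^{-1}(((xb)x)y) = b(xy), by
  \<open>moufang\<close>.\<close>

lemma shift_mult:
  assumes "x \<in> carrier L" "y \<in> carrier L"
  shows "shift Dir3 (x \<otimes> y) = shift Dir1 x \<otimes>\<^bsub>B\<^esub> shift Dir3 y \<otimes>\<^bsub>B\<^esub> shift Dir2 x"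
proof (rule BijGroup_eqI)
  fix p assume p: "p \<in> pts"
  have "shift Dir3 (x \<otimes> y) p = shift Dir1 x (shift Dir3 y (shift Dir2 x p))"
    using assms p
    by (intro coords_eqI[of Dir1 Dir2])
      (simp_all add: coord_shift shift_closed coord_closed loop_closed inv_mult_cancel_right
        middle_moufang[symmetric] moufang inv_mult_cancel)
  then show "shift Dir3 (x \<otimes> y) p = (shift Dir1 x \<otimes>\<^bsub>B\<^esub> shift Dir3 y \<otimes>\<^bsub>B\<^esub> shift Dir2 x) p"
    using assms p by (simp add: BijGroup_mult_apply shift_in_B shift_closed)
qed (use assms in \<open>auto simp: shift_in_B loop_closed\<close>)

section \<open>Direction preserving permutations and conjugates of reflections\<close>

lemma direction_preserving_iff:
  assumes f: "f \<in> carrier B"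
  shows "direction_preserving (loop_net L) f \<longleftrightarrow>
    (\<forall>i. \<forall>p\<in>pts. \<forall>q\<in>pts. coord i p = coord i q \<longleftrightarrow> coord i (f p) = coord i (f q))"
proof (rule iffI; (intro allI ballI)?)
  fix i p q
  assume dp: "direction_preserving (loop_net L) f" and p: "p \<in> pts" and q: "q \<in> pts"
  have im: "(\<lambda>l. f ` l) ` net_line i ` carrier L = net_line i ` carrier L"
    using dp by (simp add: direction_preserving_def lines_loop_net)
  have inj: "inj_on f pts" using f by (simp add: BijGroup_def Bij_def bij_betw_def)
  have fp: "f p \<in> pts" "f q \<in> pts" using p q BijGroup_apply_closed[OF f] by blast+
  show "coord i p = coord i q \<longleftrightarrow> coord i (f p) = coord i (f q)"
  proof
    assume e: "coord i p = coord i q"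
    have "f ` net_line i (coord i p) \<in> net_line i ` carrier L"
      using coord_closed[OF p] by (subst im[symmetric]) (intro imageI)
    then obtain c where "f ` net_line i (coord i p) = net_line i c" by (elim imageE)
    moreover have "f p \<in> f ` net_line i (coord i p)" "f q \<in> f ` net_line i (coord i p)"
      using p q e by (simp_all add: net_line_def)
    ultimately show "coord i (f p) = coord i (f q)" by (simp add: net_line_def)
  next
    assume e: "coord i (f p) = coord i (f q)"
    \<comment> \<open>The class is mapped onto itself, so the line through \<open>f p\<close> and
      \<open>f q\<close> is the image of some line; injectivity of \<open>f\<close> puts
      \<open>p\<close> and \<open>q\<close> on that line.\<close>
    have "net_line i (coord i (f p)) \<in> (\<lambda>l. f ` l) ` net_line i ` carrier L"
      unfolding im using coord_closed[OF fp(1)] by (rule imageI)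
    then obtain c where c: "net_line i (coord i (f p)) = f ` net_line i c" by (elim imageE) simp
    have "f p \<in> f ` net_line i c" "f q \<in> f ` net_line i c"
      using fp e unfolding c[symmetric] by (simp_all add: net_line_def)
    then obtain p' q' where pq: "p' \<in> net_line i c" "q' \<in> net_line i c" "f p = f p'" "f q = f q'"
      by blast
    then have "p = p'" "q = q'"
      using inj_onD[OF inj] p q by (auto simp: net_line_def)
    then show "coord i p = coord i q" using pq by (simp add: net_line_def)
  qed
next
  assume R: "\<forall>i. \<forall>p\<in>pts. \<forall>q\<in>pts. coord i p = coord i q \<longleftrightarrow> coord i (f p) = coord i (f q)"
  have fB: "f \<in> Bij pts" using f by (simp add: BijGroup_def)
  have im: "f ` net_line i (coord i p) = net_line i (coord i (f p))" if "p \<in> pts" for i p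
    using Bij_image_net_line[OF fB that] R that by blast
  have surj: "f ` pts = pts" using fB by (simp add: Bij_def bij_betw_def)
  have lines: "lines (loop_net L) i = (\<lambda>p. net_line i (coord i p)) ` pts" for i
    unfolding lines_loop_net using ex_coord[of _ i] coord_closed[of _ i] by (auto simp: image_iff)
  have "(\<lambda>l. f ` l) ` lines (loop_net L) i = lines (loop_net L) i" for i
  proof -
    have "(\<lambda>l. f ` l) ` lines (loop_net L) i = (\<lambda>p. net_line i (coord i p)) ` f ` pts"
      unfolding lines image_image using im by (intro image_cong) auto
    then show ?thesis unfolding surj lines .
  qed
  then show "direction_preserving (loop_net L) f" by (simp add: direction_preserving_def)
qed

lemma direction_preservingD:
  assumes "f \<in> carrier B" "direction_preserving (loop_net L) f" "p \<in> pts" "q \<in> pts"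
    and "coord i p = coord i q"
  shows "coord i (f p) = coord i (f q)"
  using assms direction_preserving_iff by blast

lemma direction_preserving_subgroup:
  "subgroup {f \<in> carrier B. direction_preserving (loop_net L) f} B" (is "subgroup ?D B")
proof (rule B.subgroupI)
  show "?D \<noteq> {}"
    using direction_preserving_iff[OF B.one_closed] B.one_closed by (auto simp: BijGroup_one_apply)
  fix f assume f: "f \<in> ?D"
  show "inv\<^bsub>B\<^esub> f \<in> ?D"
  proof -
    have fB: "f \<in> carrier B" and g: "inv\<^bsub>B\<^esub> f \<in> carrier B" using f by auto
    have "f ((inv\<^bsub>B\<^esub> f) p) = p" if "p \<in> pts" for p
      using that fB g BijGroup_mult_apply[OF fB g that] by (simp add: BijGroup_one_apply)
    moreover have "coord i ((inv\<^bsub>B\<^esub> f) p) = coord i ((inv\<^bsub>B\<^esub> f) q) \<longleftrightarrow>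
        coord i (f ((inv\<^bsub>B\<^esub> f) p)) = coord i (f ((inv\<^bsub>B\<^esub> f) q))" if "p \<in> pts" "q \<in> pts" for i p q
      using f direction_preserving_iff[OF fB] BijGroup_apply_closed[OF g] that by blast
    ultimately show ?thesis using g by (simp add: direction_preserving_iff)
  qed
  fix g assume g: "g \<in> ?D"
  have fB: "f \<in> carrier B" and gB: "g \<in> carrier B" using f g by auto
  have "coord i p = coord i q \<longleftrightarrow> coord i ((f \<otimes>\<^bsub>B\<^esub> g) p) = coord i ((f \<otimes>\<^bsub>B\<^esub> g) q)"
    if p: "p \<in> pts" and q: "q \<in> pts" for i p q
  proof -
    have "coord i p = coord i q \<longleftrightarrow> coord i (g p) = coord i (g q)"
      using g direction_preserving_iff[OF gB] p q by blast
    also have "\<dots> \<longleftrightarrow> coord i (f (g p)) = coord i (f (g q))"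
      using f direction_preserving_iff[OF fB] BijGroup_apply_closed[OF gB] p q by blast
    finally show ?thesis
      unfolding BijGroup_mult_apply[OF fB gB p] BijGroup_mult_apply[OF fB gB q] .
  qed
  then show "f \<otimes>\<^bsub>B\<^esub> g \<in> ?D"
    using fB gB direction_preserving_iff[OF B.m_closed[OF fB gB]] by blast
qed auto

lemma bol_axis:
  assumes "p \<in> pts" "m = coord i p"
  shows "bol i m p = p"
proof (rule coords_off_eqI[where i = i])
  have m: "m \<in> carrier L" using assms coord_closed by simp
  show "bol i m p \<in> pts" using m assms bol_closed by simp
  fix d assume "d \<noteq> i"
  then show "coord d (bol i m p) = coord d p"
    using assms coord_relations[OF assms(1)] m
    by (cases i; cases d) (simp_all add: coord_bol)
qed (use assms in auto)

text \<open>A reflection is constructed from incidence alone, so a permutation that respects the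
  three line classes carries it to the reflection in the image of its axis.\<close>

lemma bol_conj:
  assumes g: "g \<in> carrier B" and dp: "direction_preserving (loop_net L) g" and a: "a \<in> pts"
  shows "g \<otimes>\<^bsub>B\<^esub> bol i (coord i a) = bol i (coord i (g a)) \<otimes>\<^bsub>B\<^esub> g"
proof (rule BijGroup_eqI)
  let ?c = "coord i a" and ?m = "coord i (g a)"
  have ga: "g a \<in> pts" using BijGroup_apply_closed[OF g a] .
  have c: "?c \<in> carrier L" "?m \<in> carrier L" using coord_closed a ga by auto
  show "g \<otimes>\<^bsub>B\<^esub> bol i ?c \<in> carrier B" "bol i ?m \<otimes>\<^bsub>B\<^esub> g \<in> carrier B"
    using g c bol_in_B by auto
  fix p assume p: "p \<in> pts"
  note cl = BijGroup_apply_closed[OF g]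
  have "g (bol i ?c p) = bol i ?m (g p)"
  proof (rule coords_off_eqI[where i = i])
    show "g (bol i ?c p) \<in> pts" by (rule cl[OF bol_closed[OF c(1) p]])
    show "bol i ?m (g p) \<in> pts" by (rule bol_closed[OF c(2) cl[OF p]])
    fix d assume d: "d \<noteq> i"
    then have "third i d \<noteq> i" by (cases i; cases d) simp_all
    \<comment> \<open>\<open>r\<close> is where the axis meets the line through \<open>p\<close> that the reflection turns into direction \<open>d\<close>.\<close>
    then obtain r where r: "r \<in> pts" "coord (third i d) r = coord (third i d) p" "coord i r = ?c"
      using ex_meet[OF _ p c(1)] by blast
    have axis: "bol i ?c r = r" "bol i ?m (g r) = g r"
      using bol_axis[OF r(1) r(3)[symmetric]] bol_axis[OF cl[OF r(1)] refl, of i]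
        direction_preservingD[OF g dp r(1) a r(3)] by simp_all
    have "coord d (bol i ?c p) = coord d r"
      using coord_bol_cong[OF c(1) p r(1) r(2)[symmetric], of i] axis by (simp add: third_third)
    then have "coord d (g (bol i ?c p)) = coord d (g r)"
      using direction_preservingD[OF g dp] bol_closed[OF c(1) p] r by blast
    also have "coord d (g r) = coord d (bol i ?m (g p))"
      using coord_bol_cong[OF c(2) cl[OF r(1)] cl[OF p] direction_preservingD[OF g dp r(1) p r(2)], of i]
        axis by (simp add: third_third)
    finally show "coord d (g (bol i ?c p)) = coord d (bol i ?m (g p))" .
  qed
  then show "(g \<otimes>\<^bsub>B\<^esub> bol i ?c) p = (bol i ?m \<otimes>\<^bsub>B\<^esub> g) p"
    using p c g by (simp add: BijGroup_mult_apply bol_in_B)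
qed


section \<open>Generators of \<open>\<Gamma>\<close> and automorphisms commuting with \<open>S\<close>\<close>

definition shifts where "shifts = {shift i m | i m. m \<in> carrier L}"

text \<open>Facts about \<Gamma> are stated for \<open>T\<close>, which \<open>Gamma_eq\<close>
  identifies with its carrier.\<close>

abbreviation T where "T \<equiv> generate B shifts"

lemma shifts_in_B: "shifts \<subseteq> carrier B"
  using shift_in_B by (auto simp: shifts_def)

lemma T_subgroup: "subgroup T B"
  by (rule B.generate_is_subgroup[OF shifts_in_B])

lemma T_in_B: "t \<in> T \<Longrightarrow> t \<in> carrier B"
  by (rule B.generate_in_carrier[OF shifts_in_B])

lemma shift_in_T: "m \<in> carrier L \<Longrightarrow> shift i m \<in> T"
  by (rule generate.incl) (auto simp: shifts_def)

lemma shift_direction_preserving: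
  assumes m: "m \<in> carrier L"
  shows "direction_preserving (loop_net L) (shift j m)"
proof -
  have cong: "coord i (shift j n p) = coord i (shift j n q)"
    if "n \<in> carrier L" "p \<in> pts" "q \<in> pts" "coord i p = coord i q" for i n p q
    using that by (cases i; cases j) (simp_all add: coord_shift)
  have inv: "shift j (inv m) (shift j m p) = p" if p: "p \<in> pts" for p
  proof -
    have "shift j (inv m) (shift j m p) = (shift j (inv m) \<otimes>\<^bsub>B\<^esub> shift j m) p"
      using BijGroup_mult_apply[OF shift_in_B shift_in_B p] m inv_closed by simp
    also have "\<dots> = p"
      using B.l_inv[OF shift_in_B[OF m]] BijGroup_one_apply[OF p] m by (simp add: inv_shift)
    finally show ?thesis .
  qed
  have "coord i p = coord i q" if "p \<in> pts" "q \<in> pts" "coord i (shift j m p) = coord i (shift j m q)" for i p q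
    using cong[OF inv_closed[OF m] shift_closed[OF m that(1)] shift_closed[OF m that(2)] that(3)]
      inv that by simp
  then show ?thesis
    unfolding direction_preserving_iff[OF shift_in_B[OF m]] using cong[OF m] by blast
qed

lemma T_direction_preserving: "t \<in> T \<Longrightarrow> direction_preserving (loop_net L) t"
  using B.generate_subgroup_incl[OF _ direction_preserving_subgroup, of shifts]
    shift_in_B shift_direction_preserving by (auto simp: shifts_def)

text \<open>Let s be \<open>bol i \<one>\<close> and \<sigma> the reflection in the i-line through
  \<open>g orig\<close>. By \<open>bol_conj\<close>, \<sigma> g = g s, hence (\<sigma> s)(s g s) =
  \<sigma> g s = g. So the shift \<sigma> s is determined by g and its conjugate under s.\<close>

lemma shift_axis:
  assumes g: "g \<in> T"
  shows "shift i (coord i (g orig)) \<otimes>\<^bsub>B\<^esub> (bol i \<one> \<otimes>\<^bsub>B\<^esub> g \<otimes>\<^bsub>B\<^esub> bol i \<one>) = g"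
proof -
  have gB: "g \<in> carrier B" and dp: "direction_preserving (loop_net L) g"
    using g T_in_B T_direction_preserving by auto
  have m: "coord i (g orig) \<in> carrier L"
    by (intro coord_closed BijGroup_apply_closed[OF gB] orig_pts)
  have "bol i (coord i (g orig)) \<otimes>\<^bsub>B\<^esub> g = g \<otimes>\<^bsub>B\<^esub> bol i \<one>"
    using bol_conj[OF gB dp orig_pts, of i] by (simp add: coord_orig)
  then show ?thesis
    using gB m one_closed bol_mult_bol[OF one_closed, of i] bol_mult_bol_assoc[OF one_closed, of _ i]
    by (simp add: shift_eq bol_in_B B.m_assoc, simp add: bol_in_B flip: B.m_assoc)
      (simp add: bol_in_B B.m_assoc)
qed

lemma normalizes_bol: "B.normalizes T (bol i \<one>)"
proof (rule B.normalizes_generateI[OF shifts_in_B])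
  show "bol i \<one> \<otimes>\<^bsub>B\<^esub> h \<otimes>\<^bsub>B\<^esub> inv\<^bsub>B\<^esub> (bol i \<one>) \<in> shifts"
    and "inv\<^bsub>B\<^esub> (bol i \<one>) \<otimes>\<^bsub>B\<^esub> h \<otimes>\<^bsub>B\<^esub> bol i \<one> \<in> shifts" if "h \<in> shifts" for h
  proof -
    have "bol i \<one> \<otimes>\<^bsub>B\<^esub> h \<otimes>\<^bsub>B\<^esub> bol i \<one> \<in> shifts"
      using that bol_conj_shift inv_closed unfolding shifts_def by fastforce
    then show "bol i \<one> \<otimes>\<^bsub>B\<^esub> h \<otimes>\<^bsub>B\<^esub> inv\<^bsub>B\<^esub> (bol i \<one>) \<in> shifts"
      and "inv\<^bsub>B\<^esub> (bol i \<one>) \<otimes>\<^bsub>B\<^esub> h \<otimes>\<^bsub>B\<^esub> bol i \<one> \<in> shifts"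
      by (simp_all add: inv_bol one_closed)
  qed
qed (simp add: bol_in_B one_closed)

lemma bol_conj_T:
  assumes "t \<in> T"
  shows "bol i \<one> \<otimes>\<^bsub>B\<^esub> t \<otimes>\<^bsub>B\<^esub> bol i \<one> \<in> T"
  using normalizes_bol[of i] assms by (auto simp: B.normalizes_def inv_bol one_closed)

section \<open>The elements of \<open>S\<close> and the factorization of
  \<open>Gamma0\<close>\<close>

definition origin_elements where
  "origin_elements = {\<one>\<^bsub>B\<^esub>, bol Dir1 \<one>, bol Dir2 \<one>, bol Dir3 \<one>,
    bol Dir1 \<one> \<otimes>\<^bsub>B\<^esub> bol Dir2 \<one>, bol Dir2 \<one> \<otimes>\<^bsub>B\<^esub> bol Dir1 \<one>}"

lemma origin_elements_in_B: "origin_elements \<subseteq> carrier B"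
  by (simp add: origin_elements_def bol_in_B one_closed)

text \<open>Reflections 1 and 2 are involutions satisfying the braid relation, as in the
  presentation of S_3; hence the six words in \<open>origin_elements\<close> exhaust
  \<open>S\<close>.\<close>

lemma bol_braid:
  "bol Dir1 \<one> \<otimes>\<^bsub>B\<^esub> (bol Dir2 \<one> \<otimes>\<^bsub>B\<^esub> bol Dir1 \<one>) = bol Dir3 \<one>" (is ?P)
  "bol Dir2 \<one> \<otimes>\<^bsub>B\<^esub> (bol Dir1 \<one> \<otimes>\<^bsub>B\<^esub> bol Dir2 \<one>) = bol Dir3 \<one>" (is ?Q)
proof -
  have "bol Dir1 \<one> (bol Dir2 \<one> (bol Dir1 \<one> p)) = bol Dir3 \<one> p"
    "bol Dir2 \<one> (bol Dir1 \<one> (bol Dir2 \<one> p)) = bol Dir3 \<one> p" if p: "p \<in> pts" for p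
    by (rule coords_eqI[of Dir1 Dir2];
        use p in \<open>simp add: coord_bol bol_closed coord_closed loop_simps del: mem_Times_iff\<close>)+
  then show ?P ?Q
    by (auto intro!: BijGroup_eqI[of _ pts] simp: BijGroup_mult_apply bol_in_B one_closed bol_closed)
qed

lemma origin_elements_mult:
  assumes "s \<in> origin_elements"
  shows "bol i \<one> \<otimes>\<^bsub>B\<^esub> s \<in> origin_elements"
proof -
  let ?a = "bol Dir1 \<one>" and ?b = "bol Dir2 \<one>" and ?c = "bol Dir3 \<one>"
  have B: "?a \<in> carrier B" "?b \<in> carrier B" "?c \<in> carrier B" by (simp_all add: bol_in_B one_closed)
  note sq = bol_mult_bol[OF one_closed] bol_mult_bol_assoc[OF one_closed]
  \<comment> \<open>The braid relation gives two words for the third reflection; inserting the one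
    that has the neighbouring letter at the right end makes a square cancel.\<close>
  have ac: "?a \<otimes>\<^bsub>B\<^esub> ?c = ?b \<otimes>\<^bsub>B\<^esub> ?a" and bc: "?b \<otimes>\<^bsub>B\<^esub> ?c = ?a \<otimes>\<^bsub>B\<^esub> ?b"
    using B by (simp_all add: sq flip: bol_braid(1)) (simp_all add: sq bol_braid(1) flip: bol_braid(2))
  have ca: "?c \<otimes>\<^bsub>B\<^esub> ?a = ?a \<otimes>\<^bsub>B\<^esub> ?b"
    using B by (simp add: sq B.m_assoc flip: bol_braid(1))
  have cb: "?c \<otimes>\<^bsub>B\<^esub> ?b = ?b \<otimes>\<^bsub>B\<^esub> ?a"
    using B by (simp add: sq B.m_assoc flip: bol_braid(2))
  have cab: "?c \<otimes>\<^bsub>B\<^esub> (?a \<otimes>\<^bsub>B\<^esub> ?b) = ?a" and cba: "?c \<otimes>\<^bsub>B\<^esub> (?b \<otimes>\<^bsub>B\<^esub> ?a) = ?b"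
    using B by (simp_all add: ca cb flip: B.m_assoc) (simp_all add: sq B.m_assoc)
  show ?thesis
    using assms B by (cases i) (auto simp: origin_elements_def sq ac bc ca cb cab cba bol_braid)
qed

lemma origin_elements_direction_preserving:
  assumes s: "s \<in> origin_elements" and dp: "direction_preserving (loop_net L) s"
  shows "s = \<one>\<^bsub>B\<^esub>"
proof (rule ccontr)
  assume ne: "s \<noteq> \<one>\<^bsub>B\<^esub>"
  have sB: "s \<in> carrier B" using s origin_elements_in_B by blast
  note D = direction_preservingD[OF sB dp]
  \<comment> \<open>A net with a single point is no exception: all its collineations are the identity.\<close>
  have triv: "x = \<one>" if x: "x \<in> carrier L" for x
  proof -
    \<comment> \<open>These points lie on the 2-line and the 1-line through the origin. Each of the
      five nonidentity words moves direction 1 or direction 2, so keeping both line classes forces x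
      = 1.\<close>
    have pt: "(x, \<one>) \<in> pts" "(\<one>, x) \<in> pts" using x one_closed by auto
    have coords: "coord Dir1 (x, \<one>) = x" "coord Dir2 (x, \<one>) = \<one>" "coord Dir3 (x, \<one>) = x"
      "coord Dir1 (\<one>, x) = \<one>" "coord Dir2 (\<one>, x) = x" "coord Dir3 (\<one>, x) = x"
      using x by (simp_all add: coord.simps one_left one_right)
    have "inv x = \<one> \<Longrightarrow> x = \<one>" using inv_inv[OF x] inv_one by simp
    then show ?thesis
      using s ne D[OF pt(1) orig_pts, of Dir2] D[OF pt(2) orig_pts, of Dir1] x pt orig_pts
      by (auto simp: origin_elements_def coords coord_orig coord_bol BijGroup_mult_apply bol_in_B bol_closed
          loop_simps)
  qed
  have "s p = \<one>\<^bsub>B\<^esub> p" if "p \<in> pts" for p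
    using that triv BijGroup_apply_closed[OF sB that] by (auto simp: BijGroup_one_apply)
  then have "s = \<one>\<^bsub>B\<^esub>" using BijGroup_eqI[OF sB] by blast
  then show False using ne by simp
qed

text \<open>Left multiplication by \<open>bol i m\<close>, which is \<open>shift i m\<close> times
  \<open>bol i \<one>\<close>, keeps the factored form: \<open>bol i \<one>\<close> moves past
  \<open>t\<close> by a conjugation preserving \<open>T\<close> and is absorbed into
  \<open>s\<close>.\<close>

lemma Gamma0_decompose:
  assumes "f \<in> generate B {bol i m | i m. m \<in> carrier L}"
  shows "\<exists>t\<in>T. \<exists>s\<in>origin_elements. f = t \<otimes>\<^bsub>B\<^esub> s"
  using assms
proof (induction f rule: B.generate_left_induct)
  case one
  have "\<one>\<^bsub>B\<^esub> \<in> origin_elements" by (simp add: origin_elements_def)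
  then show ?case using generate.one[of B shifts] by (metis B.l_one B.one_closed)
next
  case (mult h k)
  obtain i m where m: "m \<in> carrier L" and h: "h = bol i m" using mult.hyps by auto
  obtain t s where ts: "t \<in> T" "s \<in> origin_elements" and k: "k = t \<otimes>\<^bsub>B\<^esub> s" using mult.IH by blast
  have in_B: "t \<in> carrier B" "s \<in> carrier B" using ts T_in_B origin_elements_in_B by auto
  let ?a = "bol i \<one>"
  have a: "?a \<in> carrier B" by (simp add: bol_in_B one_closed)
  have "h \<otimes>\<^bsub>B\<^esub> k = (shift i m \<otimes>\<^bsub>B\<^esub> (?a \<otimes>\<^bsub>B\<^esub> t \<otimes>\<^bsub>B\<^esub> ?a)) \<otimes>\<^bsub>B\<^esub> (?a \<otimes>\<^bsub>B\<^esub> s)"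
    using in_B a m unfolding h k
    by (subst bol_eq[OF m]) (simp add: B.m_assoc shift_in_B bol_mult_bol_assoc one_closed)
  moreover have "shift i m \<otimes>\<^bsub>B\<^esub> (?a \<otimes>\<^bsub>B\<^esub> t \<otimes>\<^bsub>B\<^esub> ?a) \<in> T"
    by (intro generate.eng[of _ B] shift_in_T bol_conj_T m ts)
  ultimately show ?case using origin_elements_mult[OF ts(2)] by blast
next
  case (inv h)
  then have "inv\<^bsub>B\<^esub> h = h" using inv_bol by blast
  then show ?case using inv by simp
qed (auto simp: bol_in_B)

lemma Gamma_eq: "Gamma (loop_net L) = B\<lparr>carrier := T\<rparr>"
proof -
  let ?R = "{bol i m | i m. m \<in> carrier L}"
  have R: "?R \<subseteq> carrier B" by (auto simp: bol_in_B)
  have "{f \<in> generate B ?R. direction_preserving (loop_net L) f} = T"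
  proof (intro equalityI subsetI)
    fix f assume f: "f \<in> {f \<in> generate B ?R. direction_preserving (loop_net L) f}"
    then obtain t s where ts: "t \<in> T" "s \<in> origin_elements" "f = t \<otimes>\<^bsub>B\<^esub> s" using Gamma0_decompose by blast
    have in_B: "t \<in> carrier B" "s \<in> carrier B" "f \<in> carrier B"
      using ts T_in_B origin_elements_in_B by auto
    let ?D = "{f \<in> carrier B. direction_preserving (loop_net L) f}"
    have "t \<in> ?D" "f \<in> ?D" using f in_B T_direction_preserving[OF ts(1)] by simp_all
    then have "inv\<^bsub>B\<^esub> t \<otimes>\<^bsub>B\<^esub> f \<in> ?D"
      using subgroup.m_closed[OF direction_preserving_subgroup
          subgroup.m_inv_closed[OF direction_preserving_subgroup]] by blast
    moreover have "inv\<^bsub>B\<^esub> t \<otimes>\<^bsub>B\<^esub> f = s" using in_B by (simp add: ts B.inv_cancel_left)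
    ultimately have "s = \<one>\<^bsub>B\<^esub>" using origin_elements_direction_preserving ts by auto
    then show "f \<in> T" using ts in_B by simp
  next
    fix t assume t: "t \<in> T"
    have "bol i m \<in> generate B ?R" if "m \<in> carrier L" for i m
      using that by (intro generate.incl) blast
    then have "shifts \<subseteq> generate B ?R"
      using one_closed by (auto simp: shifts_def shift_eq intro!: generate.eng)
    then have "T \<subseteq> generate B ?R"
      by (rule B.generate_subgroup_incl[OF _ B.generate_is_subgroup[OF R]])
    then show "t \<in> {f \<in> generate B ?R. direction_preserving (loop_net L) f}"
      using t T_direction_preserving by blast
  qed
  then show ?thesis
    by (simp add: Gamma_def Gamma0_def points_loop_net bol_reflections)
qed

lemma carrier_origin_group:
  "carrier (origin_group (loop_net L) (net_origin L)) = generate B (range (\<lambda>i. bol i \<one>))"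
  by (simp add: origin_group_def points_loop_net bol_reflections_origin)

lemma normalizes_origin_group:
  assumes "s \<in> generate B (range (\<lambda>i. bol i \<one>))"
  shows "B.normalizes T s"
  using assms
proof (induction s rule: B.generate_left_induct)
  case one
  show ?case using T_in_B by (auto simp: B.normalizes_def)
next
  case (mult h k)
  then show ?case using B.normalizes_mult[of T h k] normalizes_bol T_in_B by auto
qed (auto simp: inv_bol bol_in_B one_closed)

text \<open>The product of \<open>AutoGroup\<close> agrees with \<open>compose\<close> on
  bijections, so conjugation by \<open>S\<close> must first be known to give automorphisms;
  \<open>normalizes_origin_group\<close> provides this.\<close>

lemma carrier_aut_centralizer:
  "carrier (aut_centralizer (loop_net L) (net_origin L)) =
    {\<alpha> \<in> auto (B\<lparr>carrier := T\<rparr>). \<forall>s\<in>generate B (range (\<lambda>i. bol i \<one>)).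
      compose T \<alpha> (B.conj_on T s) = compose T (B.conj_on T s) \<alpha>}"
proof -
  have c: "conjugation (loop_net L) s = B.conj_on T s" for s
    by (simp add: conjugation_def B.conj_on_def Gamma_eq points_loop_net)
  have "\<alpha> \<otimes>\<^bsub>AutoGroup (B\<lparr>carrier := T\<rparr>)\<^esub> B.conj_on T s = compose T \<alpha> (B.conj_on T s)"
    "B.conj_on T s \<otimes>\<^bsub>AutoGroup (B\<lparr>carrier := T\<rparr>)\<^esub> \<alpha> = compose T (B.conj_on T s) \<alpha>"
    if "\<alpha> \<in> auto (B\<lparr>carrier := T\<rparr>)" "s \<in> generate B (range (\<lambda>i. bol i \<one>))" for \<alpha> s
  proof -
    have "\<alpha> \<in> Bij T" "B.conj_on T s \<in> Bij T"
      using that B.conj_on_auto[OF T_subgroup normalizes_origin_group] by (auto simp: auto_def)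
    then show "\<alpha> \<otimes>\<^bsub>AutoGroup (B\<lparr>carrier := T\<rparr>)\<^esub> B.conj_on T s = compose T \<alpha> (B.conj_on T s)"
      "B.conj_on T s \<otimes>\<^bsub>AutoGroup (B\<lparr>carrier := T\<rparr>)\<^esub> \<alpha> = compose T (B.conj_on T s) \<alpha>"
      using AutoGroup_mult[of _ "B\<lparr>carrier := T\<rparr>"] by auto
  qed
  moreover have "carrier (AutoGroup (B\<lparr>carrier := T\<rparr>)) = auto (B\<lparr>carrier := T\<rparr>)"
    by (simp add: AutoGroup_def)
  ultimately show ?thesis
    by (auto simp: aut_centralizer_def centralizer_def Gamma_eq c carrier_origin_group)
qed

section \<open>The action of an automorphism of \<open>L\<close> on the net and on \<Gamma>\<close>

definition lift :: "('a \<Rightarrow> 'a) \<Rightarrow> 'a \<times> 'a \<Rightarrow> 'a \<times> 'a" where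
  "lift u = (\<lambda>p\<in>pts. (u (fst p), u (snd p)))"

context
  fixes u assumes u: "u \<in> auto L"
begin

lemma auto_bij: "bij_betw u (carrier L) (carrier L)"
  using u by (simp add: auto_def Bij_def)

lemma auto_closed: "x \<in> carrier L \<Longrightarrow> u x \<in> carrier L"
  using u by (auto simp: auto_def hom_def)

lemma auto_mult: "x \<in> carrier L \<Longrightarrow> y \<in> carrier L \<Longrightarrow> u (x \<otimes> y) = u x \<otimes> u y"
  using u by (auto simp: auto_def hom_def)

lemma auto_inj: "x \<in> carrier L \<Longrightarrow> y \<in> carrier L \<Longrightarrow> u x = u y \<longleftrightarrow> x = y"
  using auto_bij by (auto simp: bij_betw_def inj_on_def)

lemma auto_one: "u \<one> = \<one>"
  using auto_mult[OF one_closed one_closed] left_cancel[of "u \<one>" "u \<one>" \<one>]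
  by (simp add: one_closed one_left one_right auto_closed)

lemma coord_lift: "p \<in> pts \<Longrightarrow> coord i (lift u p) = u (coord i p)"
  by (cases i) (auto simp: lift_def coord.simps auto_mult)

lemma lift_in_B: "lift u \<in> carrier B"
proof -
  have "bij_betw (map_prod u u) pts pts" by (rule bij_betw_map_prod[OF auto_bij auto_bij])
  then have "bij_betw (lift u) pts pts"
    by (rule bij_betw_cong[THEN iffD1, rotated]) (auto simp: lift_def)
  then show ?thesis by (simp add: BijGroup_def Bij_def) (simp add: lift_def)
qed

lemma lift_direction_preserving: "direction_preserving (loop_net L) (lift u)"
  by (simp add: direction_preserving_iff[OF lift_in_B] coord_lift auto_inj coord_closed
      del: mem_Times_iff split_paired_Ball_Sigma)

text \<open>An instance of \<open>bol_conj\<close> at any point of the axis, since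
  \<open>lift u\<close> applies \<open>u\<close> to all three labels.\<close>

lemma lift_bol:
  assumes "m \<in> carrier L"
  shows "lift u \<otimes>\<^bsub>B\<^esub> bol i m = bol i (u m) \<otimes>\<^bsub>B\<^esub> lift u"
proof -
  obtain p where p: "p \<in> pts" "coord i p = m" using ex_coord[OF assms] by blast
  then show ?thesis
    using bol_conj[OF lift_in_B lift_direction_preserving p(1), of i] by (simp add: coord_lift)
qed

lemma lift_shift:
  assumes m: "m \<in> carrier L"
  shows "lift u \<otimes>\<^bsub>B\<^esub> shift i m = shift i (u m) \<otimes>\<^bsub>B\<^esub> lift u"
proof -
  have "lift u \<otimes>\<^bsub>B\<^esub> shift i m = bol i (u m) \<otimes>\<^bsub>B\<^esub> (lift u \<otimes>\<^bsub>B\<^esub> bol i \<one>)"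
    using lift_bol[OF m, of i] lift_in_B bol_in_B m one_closed auto_closed
    by (simp add: shift_eq flip: B.m_assoc)
  then show ?thesis
    using lift_bol[OF one_closed, of i] lift_in_B bol_in_B m one_closed auto_closed
    by (simp add: shift_eq auto_one B.m_assoc)
qed

lemma lift_conj_shift:
  assumes m: "m \<in> carrier L"
  shows "lift u \<otimes>\<^bsub>B\<^esub> shift i m \<otimes>\<^bsub>B\<^esub> inv\<^bsub>B\<^esub> lift u = shift i (u m)"
    and "inv\<^bsub>B\<^esub> lift u \<otimes>\<^bsub>B\<^esub> shift i (u m) \<otimes>\<^bsub>B\<^esub> lift u = shift i m"
proof -
  note in_B = lift_in_B shift_in_B[OF m, of i] shift_in_B[OF auto_closed[OF m], of i]
  show "lift u \<otimes>\<^bsub>B\<^esub> shift i m \<otimes>\<^bsub>B\<^esub> inv\<^bsub>B\<^esub> lift u = shift i (u m)"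
    using in_B by (simp add: lift_shift[OF m] B.m_assoc)
  show "inv\<^bsub>B\<^esub> lift u \<otimes>\<^bsub>B\<^esub> shift i (u m) \<otimes>\<^bsub>B\<^esub> lift u = shift i m"
    using in_B by (simp add: B.m_assoc B.inv_cancel_left flip: lift_shift[OF m])
qed

lemma normalizes_lift: "B.normalizes T (lift u)"
proof (rule B.normalizes_generateI[OF shifts_in_B lift_in_B])
  fix h assume "h \<in> shifts"
  then obtain i m where h: "h = shift i m" "m \<in> carrier L" by (auto simp: shifts_def)
  show "lift u \<otimes>\<^bsub>B\<^esub> h \<otimes>\<^bsub>B\<^esub> inv\<^bsub>B\<^esub> lift u \<in> shifts"
    using h auto_closed by (auto simp: lift_conj_shift shifts_def)
  obtain n where "n \<in> carrier L" "m = u n"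
    using auto_bij h by (auto simp: bij_betw_def)
  then show "inv\<^bsub>B\<^esub> lift u \<otimes>\<^bsub>B\<^esub> h \<otimes>\<^bsub>B\<^esub> lift u \<in> shifts"
    using h by (auto simp: lift_conj_shift shifts_def)
qed

lemma lift_commutes_origin_group:
  assumes "s \<in> generate B (range (\<lambda>i. bol i \<one>))"
  shows "lift u \<otimes>\<^bsub>B\<^esub> s = s \<otimes>\<^bsub>B\<^esub> lift u"
  using assms
proof (induction s rule: B.generate_left_induct)
  case (mult h k)
  then obtain i where h: "h = bol i \<one>" by blast
  have "lift u \<otimes>\<^bsub>B\<^esub> h = h \<otimes>\<^bsub>B\<^esub> lift u"
    using lift_bol[OF one_closed] by (simp add: h auto_one)
  then have "lift u \<otimes>\<^bsub>B\<^esub> (h \<otimes>\<^bsub>B\<^esub> k) = h \<otimes>\<^bsub>B\<^esub> (lift u \<otimes>\<^bsub>B\<^esub> k)"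
    using mult.hyps lift_in_B bol_in_B one_closed by (simp add: h flip: B.m_assoc)
  then show ?case
    using mult lift_in_B bol_in_B one_closed by (simp add: h B.m_assoc)
qed (auto simp: inv_bol bol_in_B one_closed lift_in_B)

lemma conj_lift_in_aut_centralizer:
  "B.conj_on T (lift u) \<in> carrier (aut_centralizer (loop_net L) (net_origin L))"
  unfolding carrier_aut_centralizer
  using B.conj_on_auto[OF T_subgroup normalizes_lift]
  by (auto simp: B.compose_conj_on[OF T_subgroup] normalizes_lift normalizes_origin_group
      lift_commutes_origin_group)

lemma conj_lift_shift: "m \<in> carrier L \<Longrightarrow> B.conj_on T (lift u) (shift i m) = shift i (u m)"
  by (simp add: B.conj_on_def shift_in_T lift_conj_shift)

end

lemma lift_compose:
  assumes "u \<in> auto L" "v \<in> auto L"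
  shows "lift (compose (carrier L) u v) = lift u \<otimes>\<^bsub>B\<^esub> lift v"
  using assms lift_in_B
  by (auto simp: BijGroup_mult compose_def lift_def auto_closed intro!: ext)

section \<open>Recovering an automorphism of \<open>L\<close> from one of \<Gamma>\<close>

lemma coord_shift_orig: "m \<in> carrier L \<Longrightarrow> coord Dir1 (shift Dir3 m orig) = m"
  by (simp add: coord_shift orig_pts coord_orig one_right del: mem_Sigma_iff mem_Times_iff)

lemma shift_Dir3_inj:
  "m \<in> carrier L \<Longrightarrow> n \<in> carrier L \<Longrightarrow> shift Dir3 m = shift Dir3 n \<longleftrightarrow> m = n"
  using coord_shift_orig by metis

context
  fixes \<alpha> assumes \<alpha>: "\<alpha> \<in> carrier (aut_centralizer (loop_net L) (net_origin L))"
begin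

lemma centralizer_bij: "bij_betw \<alpha> T T"
  using \<alpha> by (simp add: carrier_aut_centralizer auto_def Bij_def)

lemma centralizer_closed: "t \<in> T \<Longrightarrow> \<alpha> t \<in> T"
  using bij_betwE[OF centralizer_bij] by blast

lemma centralizer_surj:
  assumes "s \<in> T"
  shows "\<exists>t\<in>T. \<alpha> t = s"
proof -
  have "s \<in> \<alpha> ` T" using assms bij_betw_imp_surj_on[OF centralizer_bij] by simp
  then show ?thesis by blast
qed

lemma centralizer_mult: "t \<in> T \<Longrightarrow> t' \<in> T \<Longrightarrow> \<alpha> (t \<otimes>\<^bsub>B\<^esub> t') = \<alpha> t \<otimes>\<^bsub>B\<^esub> \<alpha> t'"
  using \<alpha> by (simp add: carrier_aut_centralizer auto_def hom_def)

lemma centralizer_bol: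
  assumes t: "t \<in> T"
  shows "\<alpha> (bol i \<one> \<otimes>\<^bsub>B\<^esub> t \<otimes>\<^bsub>B\<^esub> bol i \<one>) = bol i \<one> \<otimes>\<^bsub>B\<^esub> \<alpha> t \<otimes>\<^bsub>B\<^esub> bol i \<one>"
proof -
  have "compose T \<alpha> (B.conj_on T (bol i \<one>)) t = compose T (B.conj_on T (bol i \<one>)) \<alpha> t"
    using \<alpha> generate.incl[of "bol i \<one>" "range (\<lambda>i. bol i \<one>)" B]
    by (simp add: carrier_aut_centralizer)
  then show ?thesis
    using t centralizer_closed by (simp add: compose_eq B.conj_on_def inv_bol one_closed)
qed

text \<open>By \<open>shift_axis\<close> an element of the shape \<open>shift i m\<close> is determined inside the group by any
  \<open>g\<close> carrying the origin to the line \<open>m\<close>; this shape is therefore respected by \<open>\<alpha>\<close>.\<close>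

lemma centralizer_shift_iff:
  assumes t: "t \<in> T" and g: "g \<in> T"
  shows "t = shift i (coord i (g orig)) \<longleftrightarrow> \<alpha> t = shift i (coord i (\<alpha> g orig))"
proof -
  have iff: "t = shift i (coord i (g orig)) \<longleftrightarrow> t \<otimes>\<^bsub>B\<^esub> (bol i \<one> \<otimes>\<^bsub>B\<^esub> g \<otimes>\<^bsub>B\<^esub> bol i \<one>) = g"
    if t: "t \<in> T" and g: "g \<in> T" for t g
  proof -
    have "shift i (coord i (g orig)) \<in> carrier B"
      by (intro shift_in_B coord_closed BijGroup_apply_closed[OF T_in_B[OF g]] orig_pts)
    then show ?thesis
      using shift_axis[OF g, of i] B.r_cancel T_in_B[OF t] T_in_B[OF bol_conj_T[OF g]] by metis
  qed
  have "t \<otimes>\<^bsub>B\<^esub> (bol i \<one> \<otimes>\<^bsub>B\<^esub> g \<otimes>\<^bsub>B\<^esub> bol i \<one>) = g \<longleftrightarrow>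
      \<alpha> (t \<otimes>\<^bsub>B\<^esub> (bol i \<one> \<otimes>\<^bsub>B\<^esub> g \<otimes>\<^bsub>B\<^esub> bol i \<one>)) = \<alpha> g"
    using centralizer_bij generate.eng[OF t bol_conj_T[OF g]] g
    by (auto simp: bij_betw_def inj_on_def)
  then show ?thesis
    using iff[OF t g] iff[OF centralizer_closed[OF t] centralizer_closed[OF g]]
    by (simp add: centralizer_mult t g bol_conj_T centralizer_bol)
qed

lemma centralizer_shift_Dir3:
  assumes t: "t \<in> T"
  shows "(\<exists>m\<in>carrier L. t = shift Dir3 m) \<longleftrightarrow> (\<exists>m\<in>carrier L. \<alpha> t = shift Dir3 m)"
proof -
  have coord: "coord Dir3 (g orig) \<in> carrier L" if "g \<in> T" for g
    by (intro coord_closed BijGroup_apply_closed[OF T_in_B[OF that]] orig_pts)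
  \<comment> \<open>The element g for \<open>centralizer_shift_iff\<close> is
    \<open>shift Dir1 m\<close>, which carries the origin to the 3-line labelled m;
    \<open>shift Dir3 m\<close> would carry it to the 3-line labelled mm.\<close>
  have at: "coord Dir3 (shift Dir1 m orig) = m" if "m \<in> carrier L" for m
    using that by (simp add: coord_shift orig_pts coord_orig one_right del: mem_Sigma_iff mem_Times_iff)
  show ?thesis
  proof
    assume "\<exists>m\<in>carrier L. t = shift Dir3 m"
    then obtain m where m: "m \<in> carrier L" "t = shift Dir3 m" by blast
    then have "\<alpha> t = shift Dir3 (coord Dir3 (\<alpha> (shift Dir1 m) orig))"
      using centralizer_shift_iff[OF t shift_in_T[OF m(1), of Dir1], of Dir3] by (simp add: at)
    then show "\<exists>m\<in>carrier L. \<alpha> t = shift Dir3 m"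
      using coord[OF centralizer_closed[OF shift_in_T[OF m(1)]]] by blast
  next
    assume "\<exists>m\<in>carrier L. \<alpha> t = shift Dir3 m"
    then obtain m where m: "m \<in> carrier L" "\<alpha> t = shift Dir3 m" by blast
    \<comment> \<open>For the converse the element moving the origin to the right line is prescribed
      on the image side and pulled back along \<alpha>.\<close>
    obtain g where g: "g \<in> T" "\<alpha> g = shift Dir1 m"
      using centralizer_surj[OF shift_in_T[OF m(1), of Dir1]] by blast
    have "t = shift Dir3 (coord Dir3 (g orig))"
      using centralizer_shift_iff[OF t g(1), of Dir3] m g by (simp add: at)
    then show "\<exists>m\<in>carrier L. t = shift Dir3 m" using coord[OF g(1)] by blast
  qed
qed

text \<open>Since \<alpha> commutes with conjugation by reflections 1 and 2, its effect on shifts of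
  direction 3 carries over to directions 2 and 1 with unchanged labels.\<close>

lemma centralizer_shift:
  assumes "m \<in> carrier L" "n \<in> carrier L" "\<alpha> (shift Dir3 m) = shift Dir3 n"
  shows "\<alpha> (shift i m) = shift i n"
  using centralizer_bol[OF shift_in_T[OF assms(1)], of Dir1 Dir3]
    centralizer_bol[OF shift_in_T[OF assms(1)], of Dir2 Dir3] assms
  by (cases i) (simp_all add: bol_conj_shift)

lemma ex_auto: "\<exists>u\<in>auto L. B.conj_on T (lift u) = \<alpha>"
proof -
  have "\<forall>m\<in>carrier L. \<exists>n\<in>carrier L. \<alpha> (shift Dir3 m) = shift Dir3 n"
    using centralizer_shift_Dir3 shift_in_T by blast
  then obtain v where v: "\<And>m. m \<in> carrier L \<Longrightarrow> v m \<in> carrier L"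
      "\<And>m. m \<in> carrier L \<Longrightarrow> \<alpha> (shift Dir3 m) = shift Dir3 (v m)"
    by metis
  \<comment> \<open>The restriction makes \<open>u\<close> extensional, as membership in
    \<open>auto L\<close> demands.\<close>
  define u where "u = restrict v (carrier L)"
  have cl: "u m \<in> carrier L" and shift: "\<alpha> (shift i m) = shift i (u m)" if "m \<in> carrier L" for i m
    using that v centralizer_shift[OF that] by (simp_all add: u_def)
  have mult: "u (x \<otimes> y) = u x \<otimes> u y" if x: "x \<in> carrier L" and y: "y \<in> carrier L" for x y
  proof -
    have "shift Dir3 (u (x \<otimes> y)) = \<alpha> (shift Dir3 (x \<otimes> y))"
      using shift x y by (simp add: mult_closed)
    \<comment> \<open>\<open>shift_mult\<close> expands both sides into shifts of directions 1, 3
      and 2, and \<alpha> acts on all of these through the same \<open>u\<close>.\<close>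
    also have "\<dots> = shift Dir3 (u x \<otimes> u y)"
      using x y cl
      by (simp add: shift_mult centralizer_mult shift_in_T generate.eng shift)
    finally show ?thesis using x y cl mult_closed shift_Dir3_inj by simp
  qed
  have "inj_on u (carrier L)"
  proof (rule inj_onI)
    fix x y assume xy: "x \<in> carrier L" "y \<in> carrier L" "u x = u y"
    then have "\<alpha> (shift Dir3 x) = \<alpha> (shift Dir3 y)" by (simp add: shift)
    then have "shift Dir3 x = shift Dir3 y"
      using centralizer_bij xy shift_in_T by (meson bij_betw_def inj_onD)
    then show "x = y" using shift_Dir3_inj xy by simp
  qed
  moreover have "u ` carrier L = carrier L"
  proof (intro equalityI subsetI)
    fix n assume n: "n \<in> carrier L"
    obtain t where t: "t \<in> T" "\<alpha> t = shift Dir3 n"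
      using centralizer_surj[OF shift_in_T[OF n, of Dir3]] by blast
    then obtain m where m: "m \<in> carrier L" "t = shift Dir3 m"
      using centralizer_shift_Dir3 n by blast
    then have "n = u m" using t shift[OF m(1), of Dir3] shift_Dir3_inj[OF n cl[OF m(1)]] by simp
    then show "n \<in> u ` carrier L" using m by blast
  qed (use cl in auto)
  ultimately have u: "u \<in> auto L"
    using cl mult by (simp add: auto_def hom_def Bij_def bij_betw_def u_def)
  have hom: "B.conj_on T (lift u) \<in> hom (B\<lparr>carrier := T\<rparr>) (B\<lparr>carrier := T\<rparr>)"
    "\<alpha> \<in> hom (B\<lparr>carrier := T\<rparr>) (B\<lparr>carrier := T\<rparr>)"
    using \<alpha> conj_lift_in_aut_centralizer[OF u] by (auto simp: carrier_aut_centralizer auto_def)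
  have inv: "inv\<^bsub>B\<^esub> h \<in> shifts" and eq: "B.conj_on T (lift u) h = \<alpha> h" if h: "h \<in> shifts" for h
  proof -
    obtain i m where m: "m \<in> carrier L" "h = shift i m" using h by (auto simp: shifts_def)
    show "inv\<^bsub>B\<^esub> h \<in> shifts"
      using m inv_closed[OF m(1)] unfolding shifts_def by (simp add: inv_shift) blast
    show "B.conj_on T (lift u) h = \<alpha> h" using m by (simp add: conj_lift_shift[OF u] shift)
  qed
  have "B.conj_on T (lift u) t = \<alpha> t" if "t \<in> T" for t
    by (rule B.hom_eq_on_generate[OF shifts_in_B inv hom
          subgroup.subgroup_is_group[OF T_subgroup group_BijGroup] eq that])
  moreover have "\<alpha> \<in> extensional T" using \<alpha> by (simp add: carrier_aut_centralizer auto_def Bij_def)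
  ultimately have "B.conj_on T (lift u) = \<alpha>"
    by (intro extensionalityI[of _ T]) (auto simp: B.conj_on_def)
  then show ?thesis using u by blast
qed

end

section \<open>The isomorphism\<close>

lemma auto_iso_aut_centralizer:
  "(\<lambda>u. B.conj_on T (lift u)) \<in> iso (AutoGroup L) (aut_centralizer (loop_net L) (net_origin L))"
proof -
  let ?\<Phi> = "\<lambda>u. B.conj_on T (lift u)" and ?C = "aut_centralizer (loop_net L) (net_origin L)"
  have carrier: "carrier (AutoGroup L) = auto L" by (simp add: AutoGroup_def)
  have Bij: "\<alpha> \<in> Bij T" if "\<alpha> \<in> carrier ?C" for \<alpha>
    using that by (simp add: carrier_aut_centralizer auto_def)
  have mult: "\<alpha> \<otimes>\<^bsub>?C\<^esub> \<beta> = compose T \<alpha> \<beta>" if "\<alpha> \<in> carrier ?C" "\<beta> \<in> carrier ?C" for \<alpha> \<beta>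
    using AutoGroup_mult[of \<alpha> "B\<lparr>carrier := T\<rparr>" \<beta>] Bij that by (simp add: aut_centralizer_def Gamma_eq)
  have "?\<Phi> (u \<otimes>\<^bsub>AutoGroup L\<^esub> v) = ?\<Phi> u \<otimes>\<^bsub>?C\<^esub> ?\<Phi> v" if "u \<in> auto L" "v \<in> auto L" for u v
  proof -
    have "u \<otimes>\<^bsub>AutoGroup L\<^esub> v = compose (carrier L) u v"
      using that by (simp add: AutoGroup_mult auto_def)
    then show ?thesis
      using that by (simp add: mult conj_lift_in_aut_centralizer lift_compose
          B.compose_conj_on[OF T_subgroup] normalizes_lift)
  qed
  then have "?\<Phi> \<in> hom (AutoGroup L) ?C"
    using conj_lift_in_aut_centralizer by (auto simp: hom_def carrier)
  moreover have "inj_on ?\<Phi> (auto L)"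
  proof (rule inj_onI)
    fix u v assume uv: "u \<in> auto L" "v \<in> auto L" "?\<Phi> u = ?\<Phi> v"
    \<comment> \<open>The two equal conjugations send \<open>shift Dir3 m\<close> to the shifts
      labelled \<open>u m\<close> and \<open>v m\<close>, and a shift of direction 3 determines its
      label.\<close>
    have "u m = v m" if "m \<in> carrier L" for m
      using conj_lift_shift[OF uv(1) that, of Dir3] conj_lift_shift[OF uv(2) that, of Dir3] uv that
      by (simp add: shift_Dir3_inj auto_closed)
    then show "u = v"
      using uv by (intro extensionalityI[of u "carrier L" v]) (auto simp: auto_def Bij_def)
  qed
  moreover have "?\<Phi> ` auto L = carrier ?C"
    using conj_lift_in_aut_centralizer ex_auto by blast
  ultimately show ?thesis by (simp add: iso_def bij_betw_def carrier)
qed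

end

theorem proposition2p2:
  fixes L :: "('a, 'b) monoid_scheme"
  assumes "moufang_loop L"
  shows "AutoGroup L \<cong> aut_centralizer (loop_net L) (net_origin L)"
  using moufang_loop.auto_iso_aut_centralizer[OF assms] by (rule is_isoI)

end
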